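(* Let $\eta$ be a Poisson process on $\mathbb X$ with locally finite intensity measure $\lambda$ and let $\{\eta^t:t\ge0\}$ be the associated stationary birth-and-death process with $\eta^0=\eta$. Let $f_n:\mathbf N\to\{0,1\}$, $n\in\mathbb N$, be a sequence of measurable, jump regular and non-degenerate functions. Assume that there exists a sequence $c_n\in(0,1)$, $n\ge1$, such that for every $\beta\in(0,1)$, with $b_n:=\beta c_n$, $$\mathrm{Cov}[f_n(\eta),f_n(\eta^{b_n})]\to0\quad\text{as }n\to\infty.$$ Then $|S_n\cap[0,c_n]|\to\infty$ in probability as $n\to\infty$, where $S_n:=\{t>0:f_n(\eta^t)\ne f_n(\eta^{t-})\}$ is the set of exceptional times and $|\cdot|$ denotes cardinality.
   Context: $(\mathbb X,\mathcal X)$ is a Borel space (measurably isomorphic to a Borel subset of $[0,1]$). Fix an increasing sequence $B_n\in\mathcal X$ with $B_n\uparrow\mathbb X$, and let $\mathcal X_0:=\{B\cap B_n:B\in\mathcal X,n\in\mathbb N\}$. A measure on $\mathbb X$ is locally finite if it is finite on $\mathcal X_0$. $\mathbf N$ is the set of all measures on $\mathbb X$ that are $\mathbb N_0$-valued on $\mathcal X_0$, with the $\sigma$-field generated by $\mu\mapsto\mu(B)$, $B\in\mathcal X$. A Poisson process with intensity $\lambda$ is a random element $\eta$ of $\mathbf N$ with $\eta(B)$ Poisson of mean $\lambda(B)$ and independent values on disjoint sets. The birth-and-death process $\{\eta^t:t\ge0\}$ is the homogeneous Markov process with values in $\mathbf N$, started from $\eta^0=\eta$, in which each point of $\eta$ (with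 multiplicity) has an independent unit-rate exponential lifetime and is removed at its end; independently, new points are born according to a Poisson process on $\mathbb X\times(0,\infty)$ (location, birth time) with intensity $\lambda(dx)\,dt$, each new point also having an independent unit-rate exponential lifetime. The law of $\eta$ is stationary, and $(\eta,\eta^t)$ has the same law as the pair obtained by deleting each point of $\eta$ independently with probability $1-e^{-t}$ and adding an independent Poisson process of intensity $(1-e^{-t})\lambda$. $\{f_n\}$ is non-degenerate if there is $\gamma_0\in(0,1)$ with $\gamma_0\le\mathbb E[f_n(\eta)]\le1-\gamma_0$ for all $n$. A function $f:\mathbf N\to\mathbb R$ is jump regular if almost surely $t\mapsto f(\eta^t)$ is piecewise constant, i.e. on any compact interval it equals a finite linear combination of indicators of bounded intervals of the form $[a,b)$; $f(\eta^{t-})$ denotes the left-hand limit of $s\mapsto f(\eta^s)$ at $t>0$. *)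

theory Defs
  imports "HOL-Probability.Probability"
begin

subsection \<open>The state space\<close>

text \<open>
  Only \<open>space X\<close> and \<open>sets X\<close> of the argument \<open>X\<close>, which stands for the measurable space
  of locations, are ever used; intensity measures are separate arguments.
\<close>

definition borel_isomorphic :: "'a measure \<Rightarrow> bool" where
  "borel_isomorphic X \<longleftrightarrow>
    (\<exists>A \<in> sets (borel :: real measure). A \<subseteq> {0..1} \<and>
      (\<exists>\<phi> \<in> measurable X (restrict_space borel A). \<exists>\<psi> \<in> measurable (restrict_space borel A) X.
        (\<forall>x \<in> space X. \<psi> (\<phi> x) = x) \<and> (\<forall>r \<in> A. \<phi> (\<psi> r) = r)))"

definition localizing_sequence :: "'a measure \<Rightarrow> (nat \<Rightarrow> 'a set) \<Rightarrow> bool" where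
  "localizing_sequence X B \<longleftrightarrow> range B \<subseteq> sets X \<and> incseq B \<and> (\<Union>n. B n) = space X"

definition localizing_ring :: "'a measure \<Rightarrow> (nat \<Rightarrow> 'a set) \<Rightarrow> 'a set set" where
  "localizing_ring X B = {A \<inter> B n | A n. A \<in> sets X}"

definition locally_finite_measure :: "'a measure \<Rightarrow> (nat \<Rightarrow> 'a set) \<Rightarrow> 'a measure \<Rightarrow> bool" where
  "locally_finite_measure X B \<mu> \<longleftrightarrow>
    sets \<mu> = sets X \<and> (\<forall>A \<in> localizing_ring X B. emeasure \<mu> A < \<infinity>)"

definition counting_measures :: "'a measure \<Rightarrow> (nat \<Rightarrow> 'a set) \<Rightarrow> 'a measure set" where
  "counting_measures X B =
    {\<mu>. sets \<mu> = sets X \<and> (\<forall>A \<in> localizing_ring X B. \<exists>k::nat. emeasure \<mu> A = of_nat k)}"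

text \<open>The measurable space \<open>\<^bold>N\<close>, with the \<open>\<sigma>\<close>-field generated by the evaluation maps.\<close>

definition counting_measure_space :: "'a measure \<Rightarrow> (nat \<Rightarrow> 'a set) \<Rightarrow> 'a measure measure" where
  "counting_measure_space X B =
    sigma (counting_measures X B)
      {(\<lambda>\<mu>. emeasure \<mu> A) -` C \<inter> counting_measures X B | A C.
         A \<in> sets X \<and> C \<in> sets (borel :: ennreal measure)}"

subsection \<open>Poisson processes\<close>

text \<open>
  A Poisson variable of infinite mean is almost surely infinite.  The mass function is written
  out because \<^const>\<open>poisson_pmf\<close> is restricted to positive rates, whereas mean \<open>0\<close> occurs here
  (recall \<open>0 ^ 0 = 1\<close>).
\<close>

definition poisson_variable :: "'w measure \<Rightarrow> ('w \<Rightarrow> ennreal) \<Rightarrow> ennreal \<Rightarrow> bool" where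
  "poisson_variable M Y m \<longleftrightarrow>
    (if m = \<infinity> then AE \<omega> in M. Y \<omega> = \<infinity>
     else \<forall>k::nat. measure M {\<omega> \<in> space M. Y \<omega> = of_nat k} =
            exp (- enn2real m) * enn2real m ^ k / fact k)"

text \<open>A sequence of disjoint sets covers finite families, by padding with the empty set.\<close>

definition poisson_process ::
  "'w measure \<Rightarrow> 'a measure \<Rightarrow> (nat \<Rightarrow> 'a set) \<Rightarrow> 'a measure \<Rightarrow> ('w \<Rightarrow> 'a measure) \<Rightarrow> bool" where
  "poisson_process M X B \<Lambda> \<eta> \<longleftrightarrow>
    \<eta> \<in> measurable M (counting_measure_space X B) \<and>
    (\<forall>A \<in> sets X. poisson_variable M (\<lambda>\<omega>. emeasure (\<eta> \<omega>) A) (emeasure \<Lambda> A)) \<and>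
    (\<forall>A :: nat \<Rightarrow> 'a set. range A \<subseteq> sets X \<longrightarrow> disjoint_family A \<longrightarrow>
      prob_space.indep_vars M (\<lambda>_. borel) (\<lambda>i \<omega>. emeasure (\<eta> \<omega>) (A i)) UNIV)"

subsection \<open>The birth-and-death process\<close>

text \<open>
  The sum of the Dirac measures at \<open>p i\<close>, \<open>i \<in> I\<close> (with multiplicity), as the image of the
  counting measure on \<open>I\<close>.
\<close>

definition dirac_sum :: "'a measure \<Rightarrow> 'i set \<Rightarrow> ('i \<Rightarrow> 'a) \<Rightarrow> 'a measure" where
  "dirac_sum X I p = distr (count_space I) X p"

abbreviation pos_time :: "real measure" where
  "pos_time \<equiv> restrict_space lborel {0<..}"

text \<open>
  The independent sources of randomness: the enumerated initial points, the enumerated births,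
  and the individual lifetimes of initial and of newly born points.
\<close>

datatype source = Initial_Points | Initial_Life nat | Birth_Points | Birth_Life nat

text \<open>
  Initial points are \<open>x i\<close> for \<open>i < \<kappa>\<close>, with lifetimes \<open>l i\<close>.  Births are \<open>z j\<close> for
  \<open>j < \<kappa>'\<close>, consisting of location \<open>fst (z j)\<close> and birth time \<open>snd (z j)\<close>, with lifetimes
  \<open>l' j\<close>.  The values of \<open>x\<close> and \<open>z\<close> at indices beyond \<open>\<kappa>\<close> and \<open>\<kappa>'\<close> are dummies.
\<close>

definition source_algebra ::
  "'w measure \<Rightarrow> 'a measure \<Rightarrow>
   ('w \<Rightarrow> enat) \<Rightarrow> (nat \<Rightarrow> 'w \<Rightarrow> 'a) \<Rightarrow> (nat \<Rightarrow> 'w \<Rightarrow> real) \<Rightarrow>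
   ('w \<Rightarrow> enat) \<Rightarrow> (nat \<Rightarrow> 'w \<Rightarrow> 'a \<times> real) \<Rightarrow> (nat \<Rightarrow> 'w \<Rightarrow> real) \<Rightarrow>
   source \<Rightarrow> 'w set set" where
  "source_algebra M X \<kappa> x l \<kappa>' z l' s =
    (case s of
      Initial_Points \<Rightarrow>
        sets (vimage_algebra (space M) (\<lambda>\<omega>. (\<kappa> \<omega>, \<lambda>i. x i \<omega>))
                (count_space UNIV \<Otimes>\<^sub>M (\<Pi>\<^sub>M i\<in>UNIV. X)))
    | Initial_Life i \<Rightarrow> sets (vimage_algebra (space M) (l i) borel)
    | Birth_Points \<Rightarrow>
        sets (vimage_algebra (space M) (\<lambda>\<omega>. (\<kappa>' \<omega>, \<lambda>j. z j \<omega>))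
                (count_space UNIV \<Otimes>\<^sub>M (\<Pi>\<^sub>M j\<in>UNIV. X \<Otimes>\<^sub>M pos_time)))
    | Birth_Life j \<Rightarrow> sets (vimage_algebra (space M) (l' j) borel))"

text \<open>
  Each point is alive on the half-open interval from its birth (time \<open>0\<close> for initial points) to
  its death, so that paths are right-continuous.  On \<open>X \<times> (0,\<infinity>)\<close> the localizing sequence is
  \<open>B n \<times> (0,n)\<close>.  Stationarity, the Markov property and the law of the pairs \<open>(\<eta>, \<eta> t)\<close> are
  consequences of this construction.
\<close>

definition birth_death_process ::
  "'w measure \<Rightarrow> 'a measure \<Rightarrow> (nat \<Rightarrow> 'a set) \<Rightarrow> 'a measure \<Rightarrow>
   ('w \<Rightarrow> 'a measure) \<Rightarrow> (real \<Rightarrow> 'w \<Rightarrow> 'a measure) \<Rightarrow> bool" where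
  "birth_death_process M X B \<Lambda> \<eta> \<eta>t \<longleftrightarrow>
    (\<exists>\<kappa> x l \<kappa>' z l'.
      \<kappa> \<in> measurable M (count_space UNIV) \<and> \<kappa>' \<in> measurable M (count_space UNIV) \<and>
      (\<forall>i. x i \<in> measurable M X) \<and> (\<forall>j. z j \<in> measurable M (X \<Otimes>\<^sub>M pos_time)) \<and>
      (\<forall>i. distributed M lborel (l i) (exponential_density 1)) \<and>
      (\<forall>j. distributed M lborel (l' j) (exponential_density 1)) \<and>
      (\<forall>\<omega> \<in> space M. \<forall>i. 0 < l i \<omega> \<and> 0 < l' i \<omega>) \<and>
      prob_space.indep_sets M (source_algebra M X \<kappa> x l \<kappa>' z l') UNIV \<and>
      poisson_process M X B \<Lambda> \<eta> \<and>
      (\<forall>\<omega> \<in> space M. \<eta> \<omega> = dirac_sum X {i. enat i < \<kappa> \<omega>} (\<lambda>i. x i \<omega>)) \<and>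
      poisson_process M (X \<Otimes>\<^sub>M pos_time) (\<lambda>n. B n \<times> {0<..<real n}) (\<Lambda> \<Otimes>\<^sub>M pos_time)
        (\<lambda>\<omega>. dirac_sum (X \<Otimes>\<^sub>M pos_time) {j. enat j < \<kappa>' \<omega>} (\<lambda>j. z j \<omega>)) \<and>
      (\<forall>t \<ge> 0. \<forall>\<omega> \<in> space M.
        \<eta>t t \<omega> =
          dirac_sum X
            ({i. enat i < \<kappa> \<omega> \<and> t < l i \<omega>} <+>
             {j. enat j < \<kappa>' \<omega> \<and> snd (z j \<omega>) \<le> t \<and> t < snd (z j \<omega>) + l' j \<omega>})
            (case_sum (\<lambda>i. x i \<omega>) (\<lambda>j. fst (z j \<omega>)))))"

subsection \<open>Jump regularity and exceptional times\<close>

text \<open>Paths are indexed by \<open>[0,\<infinity>)\<close>; their values at negative times are irrelevant.\<close>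

definition piecewise_constant :: "(real \<Rightarrow> real) \<Rightarrow> bool" where
  "piecewise_constant g \<longleftrightarrow>
    (\<forall>u v. 0 \<le> u \<longrightarrow> u \<le> v \<longrightarrow>
      (\<exists>(n::nat) (a :: nat \<Rightarrow> real) (b :: nat \<Rightarrow> real) (c :: nat \<Rightarrow> real).
        \<forall>t \<in> {u..v}. g t = (\<Sum>i<n. c i * indicator {a i..<b i} t)))"

definition jump_regular ::
  "'w measure \<Rightarrow> (real \<Rightarrow> 'w \<Rightarrow> 'a measure) \<Rightarrow> ('a measure \<Rightarrow> real) \<Rightarrow> bool" where
  "jump_regular M \<eta>t f \<longleftrightarrow> (AE \<omega> in M. piecewise_constant (\<lambda>t. f (\<eta>t t \<omega>)))"

definition exceptional_times :: "('a measure \<Rightarrow> real) \<Rightarrow> (real \<Rightarrow> 'a measure) \<Rightarrow> real set" where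
  "exceptional_times f \<mu> = {t. 0 < t \<and> f (\<mu> t) \<noteq> Lim (at_left t) (\<lambda>s. f (\<mu> s))}"

definition non_degenerate ::
  "'w measure \<Rightarrow> ('w \<Rightarrow> 'a measure) \<Rightarrow> (nat \<Rightarrow> 'a measure \<Rightarrow> real) \<Rightarrow> bool" where
  "non_degenerate M \<eta> f \<longleftrightarrow>
    (\<exists>\<gamma> \<in> {0<..<1}. \<forall>n. \<gamma> \<le> (\<integral>\<omega>. f n (\<eta> \<omega>) \<partial>M) \<and> (\<integral>\<omega>. f n (\<eta> \<omega>) \<partial>M) \<le> 1 - \<gamma>)"

definition covariance :: "'w measure \<Rightarrow> ('w \<Rightarrow> real) \<Rightarrow> ('w \<Rightarrow> real) \<Rightarrow> real" where
  "covariance M Y Z = (\<integral>\<omega>. (Y \<omega> - (\<integral>\<omega>'. Y \<omega>' \<partial>M)) * (Z \<omega> - (\<integral>\<omega>'. Z \<omega>' \<partial>M)) \<partial>M)"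

text \<open>
  The cardinality as an extended number: \<open>\<infinity>\<close> for infinite sets, unlike \<^const>\<open>card\<close>.
\<close>

abbreviation cardinality :: "'b set \<Rightarrow> ennreal" where
  "cardinality A \<equiv> emeasure (count_space UNIV) A"

text \<open>
  The underlying probability space is not assumed complete, and jump regularity controls paths
  only off a null set, so the event \<open>Y n \<le> K\<close> need only be measurable up to null sets.  The outer
  measure agrees with the (completed) probability on such events; \<^const>\<open>measure\<close> would silently
  be \<open>0\<close> on a non-measurable one.
\<close>

definition tends_to_infinity_in_probability :: "'w measure \<Rightarrow> (nat \<Rightarrow> 'w \<Rightarrow> ennreal) \<Rightarrow> bool" where
  "tends_to_infinity_in_probability M Y \<longleftrightarrow>
    (\<forall>K::nat. (\<lambda>n. outer_measure_of M {\<omega> \<in> space M. Y n \<omega> \<le> of_nat K}) \<longlonglongrightarrow> 0)"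

end

theory Submission
  imports Defs
begin

text \<open>
  Only the laws of the pairs \<open>(\<eta>\<^sup>s, \<eta>\<^sup>t)\<close> are needed, not the Markov property.  Cut \<open>[0, c\<^sub>n]\<close> into
  \<open>K + 1\<close> blocks and sample \<open>f\<^sub>n\<close> at \<open>k\<close> equidistant times in each block.  By stationarity the
  covariance of two samples is \<open>Cov (f\<^sub>n (\<eta>), f\<^sub>n (\<eta>\<^sup>b))\<close>, \<open>b = \<beta> c\<^sub>n\<close>, for one of finitely many \<open>\<beta> \<in> (0,1)\<close>, so
  the variance of a block average is at most \<open>1/k + o(1)\<close> and the average is close to its mean in
  \<open>[\<gamma>, 1 - \<gamma>]\<close>.  If there are at most \<open>K\<close> exceptional times, however, \<open>f\<^sub>n\<close> is constant on some
  block, whose average is then \<open>0\<close> or \<open>1\<close>.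

  Stationarity of pairs follows by computing the joint probability generating function of the
  point counts at the two times: integrating out the lifetimes replaces each point by a factor in
  \<open>[0,1]\<close>, and the expectation of the resulting product over a Poisson process is
  \<open>exp (- \<integral> (1 - h) d\<lambda>)\<close>.
\<close>

subsection \<open>Probability generating functions\<close>

text \<open>The hypothesis has no uniformity in \<beta>, so the number k of samples per block is
  fixed before n grows. Lags inside a block are m c_n / ((K + 1) k) with 1 \<le> m < k, which leaves
  k - 1 values of \<beta>, all below 1. Different blocks are never compared: a union bound over the
  K + 1 blocks is enough, and k is chosen to make (K + 1) / (k \<gamma>^2) small.

  Stationarity rests on one cancellation. An initial point is alive at time a with probability exp(-
  a), while births in (0,a] contribute the integral of exp(r - a), which is 1 - exp(- a). The total
  is 1 for every a, so only the lag b - a remains in the exponent.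

  The obstacle is the enumeration of the points. There may be infinitely many, and their locations
  may depend on each other and on their number; only the counts are Poisson. The lifetimes, however,
  are independent of the enumeration as a whole. So factors are set to 1 outside a window of finite
  intensity, products over points become limits of products over i < N, and lifetimes are averaged
  out with the enumeration held fixed.\<close>

lemma powser_eq_0_imp_coeff_0:
  fixes a :: "nat \<Rightarrow> real"
  assumes "\<And>s. 0 < s \<Longrightarrow> s < 1 \<Longrightarrow> (\<lambda>k. a k * s ^ k) sums 0"
  shows "a m = 0"
proof (induction m rule: less_induct)
  case (less m)
  \<comment> \<open>The identity is available only for positive arguments. Once the coefficients
    below \<open>m\<close> vanish, dividing by \<open>s ^ m\<close> leaves a series that is 0 on
    (0,1) and tends to \<open>a m\<close> at 0 from the right.\<close>
  have shift: "(\<lambda>k. a (k + m) * s ^ k) sums 0" if s: "0 < s" "s < 1" for s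
  proof -
    have "(\<lambda>k. a (k + m) * s ^ (k + m)) sums (0 - (\<Sum>k<m. a k * s ^ k))"
      using assms[OF s] by (rule sums_split_initial_segment)
    then have "(\<lambda>k. a (k + m) * s ^ (k + m) / s ^ m) sums (0 / s ^ m)"
      using less by (intro sums_divide) simp
    then show ?thesis using s by (simp add: power_add)
  qed
  define F where "F = (\<lambda>x::real. \<Sum>k. a (k + m) * x ^ k)"
  have "(F \<longlongrightarrow> a (0 + m)) (at 0)"
  proof (rule powser_limit_0_strong[where s="1/2" and a="\<lambda>k. a (k + m)"])
    fix x :: real assume "norm x < 1/2"
    then have "summable (\<lambda>k. a (k + m) * x ^ k)"
      by (intro powser_inside[OF sums_summable[OF shift[of "1/2"]]]) auto
    then show "(\<lambda>k. a (k + m) * x ^ k) sums F x" unfolding F_def by (rule summable_sums)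
  qed simp
  then have "(F \<longlongrightarrow> a m) (at_right 0)" by (simp add: filterlim_at_split)
  moreover have "eventually (\<lambda>x. F x = 0) (at_right 0)"
    unfolding eventually_at_right_field using shift by (auto simp: F_def sums_iff intro!: exI[of _ 1])
  then have "(F \<longlongrightarrow> 0) (at_right 0)" by (rule tendsto_eventually)
  ultimately show ?case by (metis tendsto_unique trivial_limit_at_right_real)
qed

text \<open>Expansion over the values of \<open>N\<close>. The bounded weight \<open>G\<close>
  carries the other coordinates along, so the expansion can be applied one coordinate at a
  time.\<close>

lemma (in prob_space) expectation_nat_sums:
  fixes G :: "'a \<Rightarrow> real" and N :: "'a \<Rightarrow> nat" and \<phi> :: "nat \<Rightarrow> real"
  assumes [measurable]: "G \<in> borel_measurable M" "N \<in> measurable M (count_space UNIV)"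
    and G: "\<And>\<omega>. \<bar>G \<omega>\<bar> \<le> 1" and \<phi>: "\<And>k. \<bar>\<phi> k\<bar> \<le> 1"
  shows "(\<lambda>k. expectation (\<lambda>\<omega>. G \<omega> * of_bool (N \<omega> = k)) * \<phi> k) sums expectation (\<lambda>\<omega>. G \<omega> * \<phi> (N \<omega>))"
proof -
  have "(\<Sum>k<n. G \<omega> * of_bool (N \<omega> = k) * \<phi> k) = of_bool (N \<omega> < n) * G \<omega> * \<phi> (N \<omega>)" for \<omega> n
    by (simp add: of_bool_def if_distrib if_distribR cong: if_cong)
  moreover have "(\<lambda>n. expectation (\<lambda>\<omega>. of_bool (N \<omega> < n) * G \<omega> * \<phi> (N \<omega>)))
      \<longlonglongrightarrow> expectation (\<lambda>\<omega>. G \<omega> * \<phi> (N \<omega>))"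
  proof (rule integral_dominated_convergence[where w="\<lambda>_. 1"])
    show "AE \<omega> in M. (\<lambda>n. of_bool (N \<omega> < n) * G \<omega> * \<phi> (N \<omega>)) \<longlonglongrightarrow> G \<omega> * \<phi> (N \<omega>)"
      by (intro AE_I2 tendsto_eventually eventually_mono[OF eventually_gt_at_top]) auto
    fix n
    show "AE \<omega> in M. norm (of_bool (N \<omega> < n) * G \<omega> * \<phi> (N \<omega>)) \<le> 1"
      using G \<phi> by (auto simp: abs_mult intro!: AE_I2 mult_le_one)
  qed auto
  moreover have "expectation (\<lambda>\<omega>. \<Sum>k<n. G \<omega> * of_bool (N \<omega> = k) * \<phi> k)
      = (\<Sum>k<n. expectation (\<lambda>\<omega>. G \<omega> * of_bool (N \<omega> = k)) * \<phi> k)" for n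
  proof -
    have [simp]: "integrable M (\<lambda>\<omega>. G \<omega> * of_bool (N \<omega> = k))" for k
      using G by (intro integrable_const_bound[where B=1]) (auto simp: abs_mult intro!: mult_le_one)
    show ?thesis by (subst Bochner_Integration.integral_sum) auto
  qed
  ultimately show ?thesis by (simp add: sums_def)
qed

lemma (in prob_space) pgf_eq_imp_prob_eq:
  fixes N N' :: "'j \<Rightarrow> 'a \<Rightarrow> nat"
  assumes [measurable]: "\<And>j. j \<in> J \<Longrightarrow> N j \<in> measurable M (count_space UNIV)"
      "\<And>j. j \<in> J \<Longrightarrow> N' j \<in> measurable M (count_space UNIV)"
    and "finite J"
    and eq: "\<And>s :: 'j \<Rightarrow> real. (\<And>j. 0 < s j \<and> s j < 1) \<Longrightarrow>
      expectation (\<lambda>\<omega>. \<Prod>j\<in>J. s j ^ N j \<omega>) = expectation (\<lambda>\<omega>. \<Prod>j\<in>J. s j ^ N' j \<omega>)"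
  shows "prob {\<omega> \<in> space M. \<forall>j\<in>J. N j \<omega> = k j} = prob {\<omega> \<in> space M. \<forall>j\<in>J. N' j \<omega> = k j}"
proof -
  \<comment> \<open>Induction on the set \<open>K\<close> of coordinates already converted from
    powers \<open>s j ^ N j\<close> into events \<open>N j = k j\<close>. The values
    \<open>s\<close> must stay arbitrary, because the variable of the coordinate being converted
    runs through (0,1).\<close>
  have mixed: "expectation (\<lambda>\<omega>. (\<Prod>j\<in>K. of_bool (N j \<omega> = k j)) * (\<Prod>j\<in>J - K. s j ^ N j \<omega>))
      = expectation (\<lambda>\<omega>. (\<Prod>j\<in>K. of_bool (N' j \<omega> = k j)) * (\<Prod>j\<in>J - K. s j ^ N' j \<omega>))"
    if "finite K" "K \<subseteq> J" "\<And>j. 0 < s j \<and> s j < 1" for K and s :: "'j \<Rightarrow> real"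
    using that
  proof (induction K arbitrary: s)
    case empty
    show ?case using eq[of s, OF empty.prems(2)] by simp
  next
    case (insert i K)
    then have i: "i \<in> J" "J - K = insert i (J - insert i K)" "i \<notin> J - insert i K" "K \<subseteq> J" by auto
    define G where "G N \<omega> = (\<Prod>j\<in>K. of_bool (N j \<omega> = k j)) * (\<Prod>j\<in>J - insert i K. s j ^ N j \<omega>)"
      for N :: "'j \<Rightarrow> 'a \<Rightarrow> nat" and \<omega>
    have G1: "\<bar>G N \<omega>\<bar> \<le> 1" for N \<omega>
    proof -
      have "\<bar>s j ^ N j \<omega>\<bar> \<le> 1" for j
        using insert.prems(2)[of j] by (simp add: power_le_one)
      then show ?thesis unfolding G_def abs_mult abs_prod
        by (intro mult_le_one prod_le_1 prod_nonneg conjI) auto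
    qed
    have G_meas: "G N \<in> borel_measurable M"
      if N: "\<And>j. j \<in> J \<Longrightarrow> N j \<in> measurable M (count_space UNIV)" for N :: "'j \<Rightarrow> 'a \<Rightarrow> nat"
    proof -
      have factors: "(\<lambda>\<omega>. of_bool (N j \<omega> = k j) :: real) \<in> borel_measurable M"
        "(\<lambda>\<omega>. s j ^ N j \<omega>) \<in> borel_measurable M" if "j \<in> J" for j
        using measurable_compose[OF N[OF that], of "\<lambda>n. of_bool (n = k j) :: real" borel]
          measurable_compose[OF N[OF that], of "\<lambda>n. s j ^ n" borel] by simp_all
      show ?thesis unfolding G_def using i
        by (intro borel_measurable_times borel_measurable_prod factors) auto
    qed
    have [measurable]: "G N \<in> borel_measurable M" "G N' \<in> borel_measurable M"
      using assms by (simp_all add: G_meas)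
    have [measurable]: "N i \<in> measurable M (count_space UNIV)" "N' i \<in> measurable M (count_space UNIV)"
      using i by auto
    have step: "(\<lambda>m. (expectation (\<lambda>\<omega>. G N \<omega> * of_bool (N i \<omega> = m))
          - expectation (\<lambda>\<omega>. G N' \<omega> * of_bool (N' i \<omega> = m))) * t ^ m) sums 0"
      if t: "0 < t" "t < 1" for t :: real
    proof -
      have split: "(\<Prod>j\<in>K. of_bool (N j \<omega> = k j)) * (\<Prod>j\<in>J - K. (s(i := t)) j ^ N j \<omega>) = G N \<omega> * t ^ N i \<omega>"
        for N :: "'j \<Rightarrow> 'a \<Rightarrow> nat" and \<omega>
      proof -
        have "(\<Prod>j\<in>J - K. (s(i := t)) j ^ N j \<omega>) = t ^ N i \<omega> * (\<Prod>j\<in>J - insert i K. (s(i := t)) j ^ N j \<omega>)"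
          unfolding i(2) using \<open>finite J\<close> by (subst prod.insert) auto
        also have "(\<Prod>j\<in>J - insert i K. (s(i := t)) j ^ N j \<omega>) = (\<Prod>j\<in>J - insert i K. s j ^ N j \<omega>)"
          by (intro prod.cong) auto
        finally show ?thesis by (simp add: G_def)
      qed
      have "expectation (\<lambda>\<omega>. G N \<omega> * t ^ N i \<omega>) = expectation (\<lambda>\<omega>. G N' \<omega> * t ^ N' i \<omega>)"
        using insert.IH[of "s(i := t)"] insert.prems t i unfolding split by simp
      with sums_diff[OF expectation_nat_sums[of "G N" "N i" "\<lambda>m. t ^ m"]
          expectation_nat_sums[of "G N'" "N' i" "\<lambda>m. t ^ m"]] G1 t
      show ?thesis by (simp add: left_diff_distrib power_le_one)
    qed
    then have "expectation (\<lambda>\<omega>. G N \<omega> * of_bool (N i \<omega> = k i))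
          - expectation (\<lambda>\<omega>. G N' \<omega> * of_bool (N' i \<omega> = k i)) = 0"
      by (rule powser_eq_0_imp_coeff_0)
    then show ?case using insert.hyps by (simp add: G_def mult_ac)
  qed
  have prob: "expectation (\<lambda>\<omega>. \<Prod>j\<in>J. of_bool (N j \<omega> = k j) :: real) = prob {\<omega> \<in> space M. \<forall>j\<in>J. N j \<omega> = k j}"
    for N :: "'j \<Rightarrow> 'a \<Rightarrow> nat"
  proof -
    have "(\<Prod>j\<in>J. of_bool (N j \<omega> = k j)) = (indicator {\<omega> \<in> space M. \<forall>j\<in>J. N j \<omega> = k j} \<omega> :: real)"
      if "\<omega> \<in> space M" for \<omega>
      using that \<open>finite J\<close> by (auto simp: indicator_def prod_zero_iff)
    then have "expectation (\<lambda>\<omega>. \<Prod>j\<in>J. of_bool (N j \<omega> = k j) :: real) =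
        expectation (indicator {\<omega> \<in> space M. \<forall>j\<in>J. N j \<omega> = k j})"
      by (intro Bochner_Integration.integral_cong) auto
    also have "\<dots> = prob {\<omega> \<in> space M. \<forall>j\<in>J. N j \<omega> = k j}"
      by (subst Bochner_Integration.integral_indicator) (auto intro!: arg_cong[where f=prob])
    finally show ?thesis .
  qed
  from mixed[OF \<open>finite J\<close> order_refl, of "\<lambda>_. 1/2"] show ?thesis by (simp add: prob)
qed

lemma (in prob_space) poisson_variable_pgf:
  assumes [measurable]: "Y \<in> borel_measurable M" and "poisson_variable M Y m" "m < \<infinity>"
    and N: "\<And>\<omega>. \<omega> \<in> space M \<Longrightarrow> Y \<omega> = of_nat (N \<omega>)" and t: "0 \<le> t" "t \<le> 1"
  shows "expectation (\<lambda>\<omega>. t ^ N \<omega>) = exp (- ((1 - t) * enn2real m))"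
proof -
  have [measurable]: "N \<in> measurable M (count_space UNIV)"
  proof -
    have "(\<lambda>\<omega>. nat \<lfloor>enn2real (Y \<omega>)\<rfloor>) \<in> measurable M (count_space UNIV)" by measurable
    also have "?this \<longleftrightarrow> ?thesis" by (intro measurable_cong) (simp add: N)
    finally show ?thesis .
  qed
  have P: "prob {\<omega> \<in> space M. N \<omega> = k} = exp (- enn2real m) * enn2real m ^ k / fact k" for k
  proof -
    have "{\<omega> \<in> space M. N \<omega> = k} = {\<omega> \<in> space M. Y \<omega> = of_nat k}" using N by auto
    then show ?thesis using assms(2,3) by (simp add: poisson_variable_def)
  qed
  have "expectation (\<lambda>\<omega>. of_bool (N \<omega> = k)) = prob {\<omega> \<in> space M. N \<omega> = k}" for k
  proof -
    have "expectation (\<lambda>\<omega>. of_bool (N \<omega> = k)) = expectation (indicator {\<omega> \<in> space M. N \<omega> = k})"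
      by (intro Bochner_Integration.integral_cong) (auto simp: indicator_def)
    also have "\<dots> = prob {\<omega> \<in> space M. N \<omega> = k}" by simp
    finally show ?thesis .
  qed
  then have "(\<lambda>k. exp (- enn2real m) * enn2real m ^ k / fact k * t ^ k) sums expectation (\<lambda>\<omega>. t ^ N \<omega>)"
    using expectation_nat_sums[of "\<lambda>_. 1" N "\<lambda>k. t ^ k"] t by (simp add: P power_le_one)
  moreover have "(\<lambda>k. exp (- enn2real m) * ((enn2real m * t) ^ k /\<^sub>R fact k)) sums
      (exp (- enn2real m) * exp (enn2real m * t))"
    by (intro sums_mult exp_converges)
  moreover have "exp (- enn2real m) * ((enn2real m * t) ^ k /\<^sub>R fact k) =
      exp (- enn2real m) * enn2real m ^ k / fact k * t ^ k" for k
    by (simp add: power_mult_distrib divide_simps)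
  ultimately have "expectation (\<lambda>\<omega>. t ^ N \<omega>) = exp (- enn2real m) * exp (enn2real m * t)"
    by (metis (mono_tags, lifting) sums_cong sums_unique2)
  then show ?thesis by (simp add: exp_add[symmetric] algebra_simps)
qed

subsection \<open>Independent marks\<close>

lemma measurable_sigma_vimage_algebra:
  assumes "p \<in> A" "F p = sets (vimage_algebra \<Omega> V S)" "V \<in> \<Omega> \<rightarrow> space S" "\<And>i. F i \<subseteq> Pow \<Omega>"
  shows "V \<in> measurable (sigma \<Omega> (\<Union>i\<in>A. F i)) S"
proof -
  have pow: "(\<Union>i\<in>A. F i) \<subseteq> Pow \<Omega>" using assms(4) by blast
  show ?thesis
  proof (rule measurableI)
    fix B assume "B \<in> sets S"
    then have "V -` B \<inter> \<Omega> \<in> F p" using assms(2) by (simp add: in_vimage_algebra)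
    then show "V -` B \<inter> space (sigma \<Omega> (\<Union>i\<in>A. F i)) \<in> sets (sigma \<Omega> (\<Union>i\<in>A. F i))"
      using assms(1) pow by (auto simp: space_measure_of sets_measure_of)
  qed (use assms(3) pow in \<open>auto simp: space_measure_of\<close>)
qed

text \<open>Intersection stability lets independence pass from the sources to the sigma-algebras
  generated by disjoint groups of them. The product rule for events is the form in which
  \<open>expectation_iterated\<close> consumes it.\<close>

lemma (in prob_space) prob_Int_disjoint_groups:
  assumes indep: "indep_sets F UNIV" and stable: "\<And>i. Int_stable (F i)" and disj: "A \<inter> B = {}"
    and Y: "Y \<in> measurable (sigma (space M) (\<Union>i\<in>A. F i)) S"
    and Z: "Z \<in> measurable (sigma (space M) (\<Union>i\<in>B. F i)) T"
    and CD: "C \<in> sets S" "D \<in> sets T"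
  shows "prob (Y -` C \<inter> Z -` D \<inter> space M) = prob (Y -` C \<inter> space M) * prob (Z -` D \<inter> space M)"
proof -
  have "F i \<subseteq> Pow (space M)" for i
    using indep sets.space_closed[of M] unfolding indep_sets_def by blast
  then have pow: "(\<Union>i\<in>K. F i) \<subseteq> Pow (space M)" for K by blast
  have "indep_sets (\<lambda>b. sigma_sets (space M) (\<Union>i\<in>case_bool A B b. F i)) UNIV"
  proof (rule indep_sets_collect_sigma)
    show "indep_sets F (\<Union>b\<in>UNIV. case_bool A B b)" using indep by (rule indep_sets_mono_index[rotated]) simp
    show "disjoint_family_on (case_bool A B) UNIV"
      using disj by (auto simp: disjoint_family_on_def split: bool.split)
  qed (rule stable)
  also have "(\<lambda>b. sigma_sets (space M) (\<Union>i\<in>case_bool A B b. F i)) =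
      case_bool (sigma_sets (space M) (\<Union>i\<in>A. F i)) (sigma_sets (space M) (\<Union>i\<in>B. F i))"
    by (rule ext) (simp split: bool.split)
  finally have ind: "indep_set (sigma_sets (space M) (\<Union>i\<in>A. F i)) (sigma_sets (space M) (\<Union>i\<in>B. F i))"
    unfolding indep_set_def .
  have "Y -` C \<inter> space M \<in> sigma_sets (space M) (\<Union>i\<in>A. F i)"
    "Z -` D \<inter> space M \<in> sigma_sets (space M) (\<Union>i\<in>B. F i)"
    using measurable_sets[OF Y CD(1)] measurable_sets[OF Z CD(2)] pow
    by (simp_all add: space_measure_of sets_measure_of)
  from indep_setD[OF ind this] show ?thesis by (simp add: Int_ac)
qed

lemma (in prob_space) measurable_group:
  assumes indep: "indep_sets F UNIV" and f: "f \<in> measurable (sigma (space M) (\<Union>i\<in>A. F i)) S"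
  shows "f \<in> measurable M S"
proof -
  have F: "F i \<subseteq> events" for i using indep by (auto simp: indep_sets_def)
  then have "(\<Union>i\<in>A. F i) \<subseteq> Pow (space M)" using sets.space_closed by fast
  moreover have "sigma_sets (space M) (\<Union>i\<in>A. F i) \<subseteq> events"
    using F by (intro sets.sigma_sets_subset) auto
  ultimately show ?thesis
    using f measurable_mono[OF order_refl refl, of "sigma (space M) (\<Union>i\<in>A. F i)" M S]
    by (auto simp: space_measure_of sets_measure_of)
qed

text \<open>The product rule identifies the joint law of \<open>Y\<close> and \<open>Z\<close> with
  the product of their laws, and Fubini applies. Both expectations are written over \<open>M\<close>
  itself, so repeated use involves no image measures.\<close>

lemma (in prob_space) expectation_iterated:
  fixes g :: "'s \<times> 't \<Rightarrow> real"
  assumes [measurable]: "Y \<in> measurable M S" "Z \<in> measurable M T"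
    and indep: "\<And>C D. C \<in> sets S \<Longrightarrow> D \<in> sets T \<Longrightarrow>
      prob (Y -` C \<inter> Z -` D \<inter> space M) = prob (Y -` C \<inter> space M) * prob (Z -` D \<inter> space M)"
    and g[measurable]: "g \<in> borel_measurable (S \<Otimes>\<^sub>M T)" and bound: "\<And>y. \<bar>g y\<bar> \<le> 1"
  shows "expectation (\<lambda>\<omega>. g (Y \<omega>, Z \<omega>)) = expectation (\<lambda>\<omega>. expectation (\<lambda>\<omega>'. g (Y \<omega>, Z \<omega>')))"
proof -
  interpret Y: prob_space "distr M S Y" by (rule prob_space_distr) simp
  interpret Z: prob_space "distr M T Z" by (rule prob_space_distr) simp
  interpret YZ: pair_prob_space "distr M S Y" "distr M T Z" ..
  have eq: "distr M S Y \<Otimes>\<^sub>M distr M T Z = distr M (S \<Otimes>\<^sub>M T) (\<lambda>x. (Y x, Z x))"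
  proof (rule pair_measure_eqI)
    fix C D assume "C \<in> sets (distr M S Y)" "D \<in> sets (distr M T Z)"
    then have [measurable]: "C \<in> sets S" "D \<in> sets T" by auto
    have "(\<lambda>x. (Y x, Z x)) -` (C \<times> D) \<inter> space M = Y -` C \<inter> Z -` D \<inter> space M" by auto
    then show "emeasure (distr M S Y) C * emeasure (distr M T Z) D =
        emeasure (distr M (S \<Otimes>\<^sub>M T) (\<lambda>x. (Y x, Z x))) (C \<times> D)"
      by (simp add: emeasure_distr emeasure_eq_measure indep ennreal_mult)
  qed (auto simp: Y.sigma_finite_measure_axioms Z.sigma_finite_measure_axioms)
  have [measurable]: "(\<lambda>y. \<integral>z. g (y, z) \<partial>distr M T Z) \<in> borel_measurable S"
    by (rule Z.borel_measurable_lebesgue_integral) simp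
  have "expectation (\<lambda>\<omega>. g (Y \<omega>, Z \<omega>)) = (\<integral>y. g y \<partial>(distr M S Y \<Otimes>\<^sub>M distr M T Z))"
    unfolding eq by (subst integral_distr) auto
  also have "\<dots> = (\<integral>y. \<integral>z. g (y, z) \<partial>distr M T Z \<partial>distr M S Y)"
    using bound by (intro YZ.integral_fst'[symmetric] YZ.P.integrable_const_bound[where B=1]) auto
  also have "\<dots> = expectation (\<lambda>\<omega>. \<integral>z. g (Y \<omega>, z) \<partial>distr M T Z)"
    by (subst integral_distr) auto
  also have "\<dots> = expectation (\<lambda>\<omega>. expectation (\<lambda>\<omega>'. g (Y \<omega>, Z \<omega>')))"
  proof (rule Bochner_Integration.integral_cong[OF refl])
    fix \<omega> assume "\<omega> \<in> space M"
    then have [measurable]: "(\<lambda>z. g (Y \<omega>, z)) \<in> borel_measurable T"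
      by (intro measurable_compose[OF measurable_Pair1' g]) (auto dest: measurable_space[OF assms(1)])
    show "(\<integral>z. g (Y \<omega>, z) \<partial>distr M T Z) = expectation (\<lambda>\<omega>'. g (Y \<omega>, Z \<omega>'))"
      by (subst integral_distr) auto
  qed
  finally show ?thesis .
qed

text \<open>\<open>expectation_iterated\<close> asks for a bound at every argument, whereas a
  product of real variables is bounded only on their range. Clipping to [-1,1] supplies the bound
  and changes nothing on that range.\<close>

definition truncate :: "real \<Rightarrow> real" where "truncate r = max (-1) (min 1 r)"

lemma measurable_truncate [measurable]: "truncate \<in> borel_measurable borel"
  unfolding truncate_def by measurable

lemma abs_truncate_le_1: "\<bar>truncate r\<bar> \<le> 1"
  unfolding truncate_def by auto

lemma truncate_eq: "\<bar>r\<bar> \<le> 1 \<Longrightarrow> truncate r = r"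
  unfolding truncate_def by auto

lemma (in prob_space) expectation_mult_disjoint_groups:
  fixes Y Z :: "'a \<Rightarrow> real"
  assumes indep: "indep_sets F UNIV" and stable: "\<And>i. Int_stable (F i)" and disj: "A \<inter> B = {}"
    and Y: "Y \<in> borel_measurable (sigma (space M) (\<Union>i\<in>A. F i))"
    and Z: "Z \<in> borel_measurable (sigma (space M) (\<Union>i\<in>B. F i))"
    and bound: "\<And>\<omega>. \<bar>Y \<omega>\<bar> \<le> 1" "\<And>\<omega>. \<bar>Z \<omega>\<bar> \<le> 1"
  shows "expectation (\<lambda>\<omega>. Y \<omega> * Z \<omega>) = expectation Y * expectation Z"
proof -
  define g where "g = (\<lambda>(y, z). truncate y * truncate z)"
  have "expectation (\<lambda>\<omega>. g (Y \<omega>, Z \<omega>)) = expectation (\<lambda>\<omega>. expectation (\<lambda>\<omega>'. g (Y \<omega>, Z \<omega>')))"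
  proof (rule expectation_iterated[OF measurable_group[OF indep Y] measurable_group[OF indep Z]])
    show "\<bar>g y\<bar> \<le> 1" for y
      using abs_truncate_le_1 by (auto simp: g_def abs_mult intro!: mult_le_one split: prod.split)
    show "g \<in> borel_measurable (borel \<Otimes>\<^sub>M borel)" unfolding g_def by measurable
  qed (rule prob_Int_disjoint_groups[OF indep stable disj Y Z])
  then show ?thesis by (simp add: g_def truncate_eq bound)
qed

text \<open>Covers non-integrable \<open>g\<close> too, whose integral is 0 by convention.\<close>

lemma (in prob_space) abs_expectation_le_1:
  assumes "\<And>\<omega>. \<bar>g \<omega>\<bar> \<le> (1::real)" shows "\<bar>expectation g\<bar> \<le> 1"
proof (cases "integrable M g")
  case True
  have "\<bar>expectation g\<bar> \<le> expectation (\<lambda>\<omega>. \<bar>g \<omega>\<bar>)" by (rule integral_abs_bound)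
  also have "\<dots> \<le> expectation (\<lambda>_. 1)" using assms True by (intro integral_mono) auto
  finally show ?thesis by (simp add: prob_space)
qed (simp add: not_integrable_integral_eq)

lemma abs_prod_le_1: "(\<And>i. i \<in> A \<Longrightarrow> \<bar>f i\<bar> \<le> (1::real)) \<Longrightarrow> \<bar>\<Prod>i\<in>A. f i\<bar> \<le> 1"
  unfolding abs_prod by (rule prod_le_1) auto

text \<open>The marks are independent of each other and of the whole configuration \<open>V\<close>,
  so each can be averaged with \<open>V\<close> held fixed. The induction averages out the last
  mark; the result is a function of \<open>V\<close> and is absorbed into the weight
  \<open>G\<close>, which is why \<open>G\<close> is part of the statement.\<close>

lemma (in prob_space) expectation_prod_independent_marks:
  fixes w :: "nat \<Rightarrow> 'v \<times> real \<Rightarrow> real" and l :: "nat \<Rightarrow> 'a \<Rightarrow> real"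
  assumes indep: "indep_sets F UNIV" and L: "inj L" "p \<notin> range L"
    and Fp: "F p = sets (vimage_algebra (space M) V S)"
    and FL: "\<And>i. F (L i) = sets (vimage_algebra (space M) (l i) borel)"
    and stable: "\<And>i. Int_stable (F i)"
    and V[measurable]: "V \<in> measurable M S" and l[measurable]: "\<And>i. l i \<in> borel_measurable M"
    and w[measurable]: "\<And>i. w i \<in> borel_measurable (S \<Otimes>\<^sub>M borel)" and w1: "\<And>i y. \<bar>w i y\<bar> \<le> 1"
    and G[measurable]: "G \<in> borel_measurable S" and G1: "\<And>v. \<bar>G v\<bar> \<le> 1"
  shows "expectation (\<lambda>\<omega>. G (V \<omega>) * (\<Prod>i<N. w i (V \<omega>, l i \<omega>))) =
    expectation (\<lambda>\<omega>. G (V \<omega>) * (\<Prod>i<N. expectation (\<lambda>\<omega>'. w i (V \<omega>, l i \<omega>'))))"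
  using G G1
proof (induction N arbitrary: G)
  case 0
  then show ?case by simp
next
  case (Suc N)
  note [measurable] = Suc.prems(1)
  define H where "H i v = expectation (\<lambda>\<omega>'. w i (v, l i \<omega>'))" for i v
  have [measurable]: "H i \<in> borel_measurable S" for i
    unfolding H_def by (rule borel_measurable_lebesgue_integral) measurable
  have H1: "\<bar>H i v\<bar> \<le> 1" for i v unfolding H_def by (rule abs_expectation_le_1) (rule w1)
  \<comment> \<open>The sources on which the configuration and the first \<open>N\<close> factors
    depend; the source of \<open>l N\<close> lies outside this group.\<close>
  define A where "A = insert p (L ` {..<N})"
  define \<A> where "\<A> = sigma (space M) (\<Union>i\<in>A. F i)"
  have pow: "F i \<subseteq> Pow (space M)" for i
    using indep sets.space_closed[of M] unfolding indep_sets_def by blast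
  have VA[measurable]: "V \<in> measurable \<A> S" unfolding \<A>_def
    by (rule measurable_sigma_vimage_algebra[where F=F, OF _ Fp _ pow]) (auto simp: A_def dest: measurable_space[OF V])
  have lA: "l i \<in> measurable \<A> borel" if "i < N" for i unfolding \<A>_def
    by (rule measurable_sigma_vimage_algebra[where F=F, OF _ FL _ pow]) (use that in \<open>auto simp: A_def\<close>)
  define P where "P \<omega> = (\<Prod>i<N. w i (V \<omega>, l i \<omega>))" for \<omega>
  have [measurable]: "P \<in> borel_measurable \<A>" unfolding P_def
    using lA by (intro borel_measurable_prod measurable_compose[OF _ w]) auto
  have lN: "l N \<in> measurable (sigma (space M) (\<Union>i\<in>{L N}. F i)) borel"
    by (rule measurable_sigma_vimage_algebra[where F=F, OF _ FL _ pow]) auto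
  have VP: "(\<lambda>\<omega>. (V \<omega>, P \<omega>)) \<in> measurable (sigma (space M) (\<Union>i\<in>A. F i)) (S \<Otimes>\<^sub>M borel)"
    unfolding \<A>_def[symmetric] by measurable
  have disj: "A \<inter> {L N} = {}" using L by (auto simp: A_def inj_eq)
  have truncP: "truncate (P \<omega>) = P \<omega>" for \<omega>
    unfolding P_def by (intro truncate_eq abs_prod_le_1 w1)
  define g where "g y = G (fst (fst y)) * truncate (snd (fst y)) * w N (fst (fst y), snd y)" for y
  have "expectation (\<lambda>\<omega>. G (V \<omega>) * (\<Prod>i<Suc N. w i (V \<omega>, l i \<omega>))) = expectation (\<lambda>\<omega>. g ((V \<omega>, P \<omega>), l N \<omega>))"
    by (simp add: g_def truncP) (simp add: P_def mult_ac)
  also have "\<dots> = expectation (\<lambda>\<omega>. expectation (\<lambda>\<omega>'. g ((V \<omega>, P \<omega>), l N \<omega>')))"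
  proof (rule expectation_iterated[OF measurable_group[OF indep VP] l])
    show "g \<in> borel_measurable ((S \<Otimes>\<^sub>M borel) \<Otimes>\<^sub>M borel)" unfolding g_def by measurable
    show "\<bar>g y\<bar> \<le> 1" for y
      using Suc.prems(2) abs_truncate_le_1 w1 by (auto simp: g_def abs_mult intro!: mult_le_one split: prod.split)
  qed (rule prob_Int_disjoint_groups[OF indep stable disj VP lN])
  also have "\<dots> = expectation (\<lambda>\<omega>. (G (V \<omega>) * H N (V \<omega>)) * P \<omega>)"
    by (simp add: g_def truncP H_def mult_ac)
  also have "\<dots> = expectation (\<lambda>\<omega>. (G (V \<omega>) * H N (V \<omega>)) * (\<Prod>i<N. H i (V \<omega>)))"
    unfolding P_def H_def[of _ "V _"]
    by (rule Suc.IH) (use Suc.prems(2) H1 H1[unfolded H_def] in \<open>auto simp: abs_mult intro!: mult_le_one\<close>)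
  finally show ?case by (simp add: H_def mult_ac)
qed

lemma prod_lessThan_tendsto_prod:
  fixes f :: "nat \<Rightarrow> real"
  assumes "finite I" "\<And>i. i \<notin> I \<Longrightarrow> f i = 1"
  shows "(\<lambda>N. \<Prod>i<N. f i) \<longlonglongrightarrow> (\<Prod>i\<in>I. f i)"
proof (rule tendsto_eventually, rule eventually_mono)
  obtain m where "\<And>i. i \<in> I \<Longrightarrow> i < m" using assms(1) by (meson finite_nat_bounded lessThan_iff subsetD)
  then show "\<forall>\<^sub>F N in sequentially. I \<subseteq> {..<N}"
    by (intro eventually_mono[OF eventually_ge_at_top[of m]]) (auto intro: less_le_trans)
  fix N assume "I \<subseteq> {..<N}"
  then show "(\<Prod>i<N. f i) = (\<Prod>i\<in>I. f i)"
    using assms(2) by (intro prod.mono_neutral_right) auto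
qed

subsection \<open>The generating functional of a Poisson process\<close>

lemma emeasure_dirac_sum:
  assumes "p ` I \<subseteq> space E" "A \<in> sets E"
  shows "emeasure (dirac_sum E I p) A = emeasure (count_space UNIV) {i\<in>I. p i \<in> A}"
proof -
  have "p -` A \<inter> I = {i\<in>I. p i \<in> A}" by auto
  moreover have "p \<in> measurable (count_space I) E" using assms(1) by auto
  ultimately show ?thesis
    using assms(2) unfolding dirac_sum_def by (subst emeasure_distr) (auto simp: emeasure_count_space)
qed

lemma emeasure_count_space_UNIV_eq_of_natD:
  assumes "emeasure (count_space UNIV) I = of_nat k"
  shows "finite I"
  using assms by (auto simp: emeasure_count_space split: if_splits)

lemma counting_measuresD:
  assumes "\<mu> \<in> counting_measures E C" "A \<in> localizing_ring E C"
  obtains k :: nat where "emeasure \<mu> A = of_nat k"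
  using assms unfolding counting_measures_def by auto

lemma space_counting_measure_space: "space (counting_measure_space E C) = counting_measures E C"
  unfolding counting_measure_space_def by (rule space_measure_of) auto

lemma localizing_ring_subset:
  assumes "D \<in> localizing_ring E C" "A \<subseteq> D" "A \<in> sets E"
  shows "A \<in> localizing_ring E C"
proof -
  obtain D' n where "D = D' \<inter> C n" using assms(1) unfolding localizing_ring_def by auto
  then have "A = A \<inter> C n" using assms(2) by auto
  then show ?thesis using assms(3) unfolding localizing_ring_def by auto
qed

lemma measurable_emeasure_counting_measure_space:
  assumes "A \<in> sets E"
  shows "(\<lambda>\<mu>. emeasure \<mu> A) \<in> borel_measurable (counting_measure_space E C)"
proof (rule measurableI)
  fix S :: "ennreal set" assume "S \<in> sets borel"
  then show "(\<lambda>\<mu>. emeasure \<mu> A) -` S \<inter> space (counting_measure_space E C) \<in> sets (counting_measure_space E C)"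
    using assms unfolding space_counting_measure_space
    unfolding counting_measure_space_def by (subst sets_measure_of) (auto intro!: sigma_sets.Basic)
qed auto

text \<open>Common setting of the initial points on \<open>X\<close> and of the births on
  \<open>X \<times> (0,\<infinity>)\<close>. Beyond measurability and the Poisson property of the
  resulting measure, the joint law of \<open>\<kappa>\<close> and the \<open>x i\<close> is left
  open.\<close>

locale enumerated_poisson_process = prob_space M for M :: "'w measure" +
  fixes E :: "'e measure" and C :: "nat \<Rightarrow> 'e set" and \<Lambda> :: "'e measure"
    and \<kappa> :: "'w \<Rightarrow> enat" and x :: "nat \<Rightarrow> 'w \<Rightarrow> 'e"
  assumes poisson: "poisson_process M E C \<Lambda> (\<lambda>\<omega>. dirac_sum E {i. enat i < \<kappa> \<omega>} (\<lambda>i. x i \<omega>))"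
    and \<kappa>_measurable [measurable]: "\<kappa> \<in> measurable M (count_space UNIV)"
    and x_measurable [measurable]: "\<And>i. x i \<in> measurable M E"
    and sets_intensity [simp]: "sets \<Lambda> = sets E"
begin

lemma measurable_points:
  "(\<lambda>\<omega>. (\<kappa> \<omega>, \<lambda>i. x i \<omega>)) \<in> measurable M (count_space UNIV \<Otimes>\<^sub>M (\<Pi>\<^sub>M i\<in>UNIV. E))"
proof -
  have "(\<lambda>\<omega>. \<lambda>i\<in>UNIV. x i \<omega>) \<in> measurable M (\<Pi>\<^sub>M i\<in>UNIV. E)" by (rule measurable_restrict) simp
  then show ?thesis by (intro measurable_Pair) (simp_all add: restrict_def)
qed

text \<open>Indices rather than locations, so that multiple points keep their multiplicity.\<close>

definition points_in :: "'e set \<Rightarrow> 'w \<Rightarrow> nat set" where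
  "points_in D \<omega> = {i. enat i < \<kappa> \<omega> \<and> x i \<omega> \<in> D}"

lemma emeasure_points:
  assumes "\<omega> \<in> space M" "A \<in> sets E"
  shows "emeasure (dirac_sum E {i. enat i < \<kappa> \<omega>} (\<lambda>i. x i \<omega>)) A = emeasure (count_space UNIV) (points_in A \<omega>)"
  using assms by (subst emeasure_dirac_sum) (auto simp: points_in_def dest: measurable_space[OF x_measurable])

lemma finite_points_in:
  assumes "\<omega> \<in> space M" "D \<in> sets E" "D \<in> localizing_ring E C"
  shows "finite (points_in D \<omega>)"
proof -
  have "dirac_sum E {i. enat i < \<kappa> \<omega>} (\<lambda>i. x i \<omega>) \<in> counting_measures E C"
    using poisson assms(1) unfolding poisson_process_def
    by (auto dest: measurable_space simp: space_counting_measure_space)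
  then show ?thesis
    using assms emeasure_points[of \<omega> D] by (metis counting_measuresD emeasure_count_space_UNIV_eq_of_natD)
qed

text \<open>Replaces the random index set by the deterministic ranges \<open>i < N\<close>: factors
  off \<open>D\<close> are 1 and only finitely many points lie in \<open>D\<close>. This yields
  measurability, and it makes statements about finite products applicable even when
  \<open>\<kappa>\<close> is infinite.\<close>

lemma partial_prods_tendsto:
  fixes w :: "nat \<Rightarrow> 'w \<Rightarrow> real"
  assumes "\<omega> \<in> space M" "D \<in> sets E" "D \<in> localizing_ring E C" and "\<And>i. x i \<omega> \<notin> D \<Longrightarrow> w i \<omega> = 1"
  shows "(\<lambda>N. \<Prod>i<N. if enat i < \<kappa> \<omega> then w i \<omega> else 1) \<longlonglongrightarrow> (\<Prod>i\<in>points_in D \<omega>. w i \<omega>)"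
proof -
  have "(\<lambda>N. \<Prod>i<N. if enat i < \<kappa> \<omega> then w i \<omega> else 1) \<longlonglongrightarrow>
      (\<Prod>i\<in>points_in D \<omega>. if enat i < \<kappa> \<omega> then w i \<omega> else 1)"
    using assms(4) by (intro prod_lessThan_tendsto_prod finite_points_in[OF assms(1-3)]) (auto simp: points_in_def)
  also have "(\<Prod>i\<in>points_in D \<omega>. if enat i < \<kappa> \<omega> then w i \<omega> else 1) = (\<Prod>i\<in>points_in D \<omega>. w i \<omega>)"
    by (intro prod.cong) (auto simp: points_in_def)
  finally show ?thesis .
qed

lemma measurable_prod_points_in:
  assumes [measurable]: "h \<in> borel_measurable E" "D \<in> sets E" and D: "D \<in> localizing_ring E C"
  shows "(\<lambda>\<omega>. \<Prod>i\<in>points_in D \<omega>. h (x i \<omega>) :: real) \<in> borel_measurable M"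
proof -
  define w where "w i \<omega> = (if x i \<omega> \<in> D then h (x i \<omega>) else 1)" for i \<omega>
  have [measurable]: "w i \<in> borel_measurable M" for i unfolding w_def by measurable
  have "(\<lambda>N. \<Prod>i<N. if enat i < \<kappa> \<omega> then w i \<omega> else 1) \<longlonglongrightarrow> (\<Prod>i\<in>points_in D \<omega>. h (x i \<omega>))"
    if "\<omega> \<in> space M" for \<omega>
  proof -
    have "(\<Prod>i\<in>points_in D \<omega>. h (x i \<omega>)) = (\<Prod>i\<in>points_in D \<omega>. w i \<omega>)"
      by (intro prod.cong) (auto simp: points_in_def w_def)
    moreover have "w i \<omega> = 1" if "x i \<omega> \<notin> D" for i using that by (simp add: w_def)
    ultimately show ?thesis using partial_prods_tendsto[OF that assms(2) D, of w] by simp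
  qed
  then show ?thesis by (rule borel_measurable_LIMSEQ_real) measurable
qed

text \<open>The case of a weight \<open>t \<circ> g\<close> with finitely many values. The counts in
  its level sets are independent Poisson variables, the level \<open>m\<close> contributes
  \<open>t m\<close> to the power of its count, and the exponents
  \<open>(1 - t m) * measure \<Lambda> (A m)\<close> add up to the integral.\<close>

lemma pgfl_step:
  fixes g :: "'e \<Rightarrow> nat" and t :: "nat \<Rightarrow> real"
  assumes D: "D \<in> sets E" "D \<in> localizing_ring E C" "emeasure \<Lambda> D < \<infinity>"
    and g[measurable]: "g \<in> measurable E (count_space UNIV)" and gn: "\<And>y. g y < n"
    and t: "\<And>m. 0 \<le> t m \<and> t m \<le> 1"
  shows "expectation (\<lambda>\<omega>. \<Prod>i\<in>points_in D \<omega>. t (g (x i \<omega>))) =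
    exp (- (\<integral>y. (1 - t (g y)) * indicator D y \<partial>\<Lambda>))"
proof -
  note [measurable] = D(1)
  define A where "A m = {y \<in> D. g y = m}" for m
  have A_eq: "A m = D \<inter> (g -` {m} \<inter> space E)" for m
    using sets.sets_into_space[OF D(1)] by (auto simp: A_def)
  have A[measurable]: "A m \<in> sets E" for m unfolding A_eq by measurable
  have A_loc: "A m \<in> localizing_ring E C" for m
    by (rule localizing_ring_subset[OF D(2) _ A]) (auto simp: A_def)
  have A_fin: "emeasure \<Lambda> (A m) < \<infinity>" for m
    using D(1) by (intro le_less_trans[OF emeasure_mono D(3)]) (auto simp: A_def)
  define \<Phi> where "\<Phi> \<omega> = dirac_sum E {i. enat i < \<kappa> \<omega>} (\<lambda>i. x i \<omega>)" for \<omega>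
  define N where "N m \<omega> = card (points_in (A m) \<omega>)" for m \<omega>
  have N: "emeasure (\<Phi> \<omega>) (A m) = of_nat (N m \<omega>)" if "\<omega> \<in> space M" for m \<omega>
    unfolding \<Phi>_def using finite_points_in[OF that A A_loc]
    by (simp add: emeasure_points[OF that A] N_def emeasure_count_space)
  have [measurable]: "\<Phi> \<in> measurable M (counting_measure_space E C)"
    using poisson unfolding poisson_process_def \<Phi>_def by simp
  have \<Phi>_meas[measurable]: "(\<lambda>\<omega>. emeasure (\<Phi> \<omega>) (A m)) \<in> borel_measurable M" for m
    by (rule measurable_compose[OF \<open>\<Phi> \<in> _\<close> measurable_emeasure_counting_measure_space[OF A]])
  have "disjoint_family A" by (auto simp: disjoint_family_on_def A_def)
  moreover have "range A \<subseteq> sets E" by auto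
  ultimately have "indep_vars (\<lambda>_. borel) (\<lambda>m \<omega>. emeasure (\<Phi> \<omega>) (A m)) UNIV"
    using poisson unfolding poisson_process_def \<Phi>_def by blast
  then have "indep_vars (\<lambda>_. borel) (\<lambda>m \<omega>. emeasure (\<Phi> \<omega>) (A m)) {..<n}"
    by (rule indep_vars_subset) simp
  \<comment> \<open>Rounding turns the power into a function of the extended-valued count, for which
    the definition of a Poisson process provides independence.\<close>
  then have indep: "indep_vars (\<lambda>_. borel) (\<lambda>m \<omega>. t m ^ nat \<lfloor>enn2real (emeasure (\<Phi> \<omega>) (A m))\<rfloor>) {..<n}"
    by (rule indep_vars_compose2) measurable
  have group: "(\<Prod>i\<in>points_in D \<omega>. t (g (x i \<omega>))) = (\<Prod>m<n. t m ^ nat \<lfloor>enn2real (emeasure (\<Phi> \<omega>) (A m))\<rfloor>)"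
    if \<omega>: "\<omega> \<in> space M" for \<omega>
  proof -
    have "(\<Prod>i\<in>points_in D \<omega>. t (g (x i \<omega>))) =
        (\<Prod>m<n. \<Prod>i\<in>{i\<in>points_in D \<omega>. g (x i \<omega>) = m}. t (g (x i \<omega>)))"
      using finite_points_in[OF \<omega> D(1,2)] gn by (intro prod.group[symmetric]) auto
    also have "\<dots> = (\<Prod>m<n. t m ^ N m \<omega>)"
      by (intro prod.cong) (auto simp: N_def points_in_def A_def conj_assoc)
    finally show ?thesis by (simp add: N \<omega>)
  qed
  have "expectation (\<lambda>\<omega>. \<Prod>i\<in>points_in D \<omega>. t (g (x i \<omega>))) =
      expectation (\<lambda>\<omega>. \<Prod>m<n. t m ^ nat \<lfloor>enn2real (emeasure (\<Phi> \<omega>) (A m))\<rfloor>)"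
    by (intro Bochner_Integration.integral_cong group) auto
  also have "\<dots> = (\<Prod>m<n. expectation (\<lambda>\<omega>. t m ^ nat \<lfloor>enn2real (emeasure (\<Phi> \<omega>) (A m))\<rfloor>))"
    using t by (intro indep_vars_lebesgue_integral indep integrable_const_bound[where B=1])
      (auto simp: power_le_one abs_of_nonneg power_abs)
  also have "\<dots> = (\<Prod>m<n. exp (- ((1 - t m) * measure \<Lambda> (A m))))"
  proof (intro prod.cong refl)
    fix m
    have "poisson_variable M (\<lambda>\<omega>. emeasure (\<Phi> \<omega>) (A m)) (emeasure \<Lambda> (A m))"
      using poisson unfolding poisson_process_def \<Phi>_def by simp
    from poisson_variable_pgf[OF _ this A_fin, of "N m" "t m"] t
    have "expectation (\<lambda>\<omega>. t m ^ N m \<omega>) = exp (- ((1 - t m) * measure \<Lambda> (A m)))"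
      by (simp add: N measure_def)
    also have "expectation (\<lambda>\<omega>. t m ^ N m \<omega>) =
        expectation (\<lambda>\<omega>. t m ^ nat \<lfloor>enn2real (emeasure (\<Phi> \<omega>) (A m))\<rfloor>)"
      by (intro Bochner_Integration.integral_cong) (auto simp: N)
    finally show "expectation (\<lambda>\<omega>. t m ^ nat \<lfloor>enn2real (emeasure (\<Phi> \<omega>) (A m))\<rfloor>) =
        exp (- ((1 - t m) * measure \<Lambda> (A m)))" .
  qed
  also have "\<dots> = exp (- (\<Sum>m<n. (1 - t m) * measure \<Lambda> (A m)))"
    by (simp add: exp_sum sum_negf[symmetric])
  also have "(\<Sum>m<n. (1 - t m) * measure \<Lambda> (A m)) = (\<integral>y. (\<Sum>m<n. (1 - t m) * indicator (A m) y) \<partial>\<Lambda>)"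
    using A_fin A by (subst Bochner_Integration.integral_sum) (auto simp: less_top[symmetric])
  also have "\<dots> = (\<integral>y. (1 - t (g y)) * indicator D y \<partial>\<Lambda>)"
  proof (intro Bochner_Integration.integral_cong refl)
    fix y
    have "(\<Sum>m<n. (1 - t m) * indicator (A m) y) = (\<Sum>m<n. if g y = m then (1 - t m) * indicator D y else 0)"
      by (intro sum.cong) (auto simp: A_def indicator_def)
    then show "(\<Sum>m<n. (1 - t m) * indicator (A m) y) = (1 - t (g y)) * indicator D y"
      using gn[of y] by simp
  qed
  finally show ?thesis .
qed

lemma pgfl:
  fixes h :: "'e \<Rightarrow> real"
  assumes D: "D \<in> sets E" "D \<in> localizing_ring E C" "emeasure \<Lambda> D < \<infinity>"
    and h[measurable]: "h \<in> borel_measurable E" and h01: "\<And>y. 0 \<le> h y \<and> h y \<le> 1"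
  shows "expectation (\<lambda>\<omega>. \<Prod>i\<in>points_in D \<omega>. h (x i \<omega>)) =
    exp (- (\<integral>y. (1 - h y) * indicator D y \<partial>\<Lambda>))"
proof -
  note [measurable] = D(1)
  \<comment> \<open>\<open>t k (g k y)\<close> is \<open>h y\<close> rounded down to a multiple of
    1/(k + 1): finitely many values, and an error of at most 1/(k + 1). The minimum in
    \<open>t\<close> only enforces a value in [0,1] at every index, as \<open>pgfl_step\<close>
    demands.\<close>
  define g where "g k y = nat \<lfloor>real (Suc k) * h y\<rfloor>" for k y
  define t where "t k m = min 1 (real m / real (Suc k))" for k m
  have [measurable]: "g k \<in> measurable E (count_space UNIV)" for k unfolding g_def by measurable
  have g_bd: "g k y < Suc (Suc k)" for k y
  proof -
    have "real (Suc k) * h y \<le> real (Suc k) * 1" using h01 by (intro mult_left_mono) auto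
    then have "\<lfloor>real (Suc k) * h y\<rfloor> \<le> \<lfloor>real (Suc k)\<rfloor>" by (intro floor_mono) simp
    then have "\<lfloor>real (Suc k) * h y\<rfloor> \<le> int (Suc k)" by (simp only: floor_of_nat)
    then show ?thesis unfolding g_def by linarith
  qed
  have t01: "0 \<le> t k m \<and> t k m \<le> 1" for k m unfolding t_def by auto
  have approx: "\<bar>t k (g k y) - h y\<bar> \<le> 1 / real (Suc k)" for k y
  proof -
    have nn: "0 \<le> real (Suc k) * h y" using h01 by simp
    have "g k y \<le> Suc k" using g_bd[of k y] by simp
    then have "real (g k y) / real (Suc k) \<le> 1" by simp
    then have "t k (g k y) = real (g k y) / real (Suc k)" unfolding t_def by (rule min_absorb2)
    moreover have "\<bar>real (g k y) - real (Suc k) * h y\<bar> \<le> 1" unfolding g_def using nn by linarith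
    then have "\<bar>real (g k y) - real (Suc k) * h y\<bar> / real (Suc k) \<le> 1 / real (Suc k)"
      by (intro divide_right_mono) auto
    moreover have "real (g k y) / real (Suc k) - h y = (real (g k y) - real (Suc k) * h y) / real (Suc k)"
      by (simp add: field_simps)
    ultimately show ?thesis by (simp only: abs_divide abs_of_nat)
  qed
  have lim: "(\<lambda>k. t k (g k y)) \<longlonglongrightarrow> h y" for y
  proof (rule LIM_zero_cancel, rule Lim_null_comparison)
    show "\<forall>\<^sub>F k in sequentially. norm (t k (g k y) - h y) \<le> 1 / real (Suc k)" using approx by simp
    show "(\<lambda>k. 1 / real (Suc k)) \<longlonglongrightarrow> 0" by (rule lim_1_over_n[THEN LIMSEQ_Suc])
  qed
  have tg[measurable]: "(\<lambda>y. t k (g k y)) \<in> borel_measurable E" for k by measurable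
  have "(\<lambda>k. expectation (\<lambda>\<omega>. \<Prod>i\<in>points_in D \<omega>. t k (g k (x i \<omega>)))) \<longlonglongrightarrow>
      expectation (\<lambda>\<omega>. \<Prod>i\<in>points_in D \<omega>. h (x i \<omega>))"
  proof (rule integral_dominated_convergence[where w="\<lambda>_. 1"])
    show "AE \<omega> in M. (\<lambda>k. \<Prod>i\<in>points_in D \<omega>. t k (g k (x i \<omega>))) \<longlonglongrightarrow> (\<Prod>i\<in>points_in D \<omega>. h (x i \<omega>))"
      by (intro AE_I2 tendsto_prod lim)
    show "AE \<omega> in M. norm (\<Prod>i\<in>points_in D \<omega>. t k (g k (x i \<omega>))) \<le> 1" for k
      unfolding real_norm_def using t01 by (intro AE_I2 abs_prod_le_1) auto
  qed (auto intro!: measurable_prod_points_in D tg h)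
  moreover have "(\<lambda>k. exp (- (\<integral>y. (1 - t k (g k y)) * indicator D y \<partial>\<Lambda>))) \<longlonglongrightarrow>
      exp (- (\<integral>y. (1 - h y) * indicator D y \<partial>\<Lambda>))"
  proof (intro tendsto_exp tendsto_minus integral_dominated_convergence[where w="indicator D"])
    show "integrable \<Lambda> (indicator D :: 'e \<Rightarrow> real)" using D(1,3) by (simp add: less_top[symmetric])
    show "AE y in \<Lambda>. (\<lambda>k. (1 - t k (g k y)) * indicator D y) \<longlonglongrightarrow> (1 - h y) * indicator D y"
      by (intro AE_I2 tendsto_intros lim)
    show "AE y in \<Lambda>. norm ((1 - t k (g k y)) * indicator D y) \<le> indicator D y" for k
      using t01 by (intro AE_I2) (auto simp: indicator_def)
    show "(\<lambda>y. (1 - h y) * indicator D y) \<in> borel_measurable \<Lambda>"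
      "(\<lambda>y. (1 - t k (g k y)) * indicator D y) \<in> borel_measurable \<Lambda>" for k
      unfolding measurable_cong_sets[OF sets_intensity refl] by measurable
  qed
  moreover have "expectation (\<lambda>\<omega>. \<Prod>i\<in>points_in D \<omega>. t k (g k (x i \<omega>))) =
      exp (- (\<integral>y. (1 - t k (g k y)) * indicator D y \<partial>\<Lambda>))" for k
    by (rule pgfl_step[OF D _ g_bd t01]) simp
  ultimately show ?thesis by (auto intro: LIMSEQ_unique)
qed

end

text \<open>\<open>F\<close> is one independent family of all sources of randomness;
  \<open>p\<close> is the index of the point configuration and \<open>L i\<close> that of the i-th
  mark. Two processes at disjoint indices of the same \<open>F\<close> can then be shown
  independent.\<close>

locale marked_poisson_process = enumerated_poisson_process M E C \<Lambda> \<kappa> x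
  for M :: "'w measure" and E :: "'e measure" and C \<Lambda> \<kappa> x +
  fixes F :: "'s \<Rightarrow> 'w set set" and p :: 's and L :: "nat \<Rightarrow> 's" and l :: "nat \<Rightarrow> 'w \<Rightarrow> real"
  assumes indep: "indep_sets F UNIV" and stable: "\<And>i. Int_stable (F i)"
    and L: "inj L" "p \<notin> range L"
    and F_points: "F p = sets (vimage_algebra (space M) (\<lambda>\<omega>. (\<kappa> \<omega>, \<lambda>i. x i \<omega>))
      (count_space UNIV \<Otimes>\<^sub>M (\<Pi>\<^sub>M i\<in>UNIV. E)))"
    and F_marks: "\<And>i. F (L i) = sets (vimage_algebra (space M) (l i) borel)"
    and l_measurable [measurable]: "\<And>i. l i \<in> borel_measurable M"
begin

definition point_algebra :: "'w measure" where
  "point_algebra = sigma (space M) (\<Union>i\<in>insert p (range L). F i)"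

lemma space_point_algebra: "space point_algebra = space M"
proof -
  have "F i \<subseteq> Pow (space M)" for i
    using indep sets.space_closed[of M] unfolding indep_sets_def by blast
  then show ?thesis unfolding point_algebra_def by (intro space_measure_of) blast
qed

lemma measurable_point_algebra:
  "(\<lambda>\<omega>. (\<kappa> \<omega>, \<lambda>i. x i \<omega>)) \<in> measurable point_algebra (count_space UNIV \<Otimes>\<^sub>M (\<Pi>\<^sub>M i\<in>UNIV. E))"
  "l i \<in> borel_measurable point_algebra"
proof -
  have pow: "F i \<subseteq> Pow (space M)" for i
    using indep sets.space_closed[of M] unfolding indep_sets_def by blast
  show "(\<lambda>\<omega>. (\<kappa> \<omega>, \<lambda>i. x i \<omega>)) \<in> measurable point_algebra (count_space UNIV \<Otimes>\<^sub>M (\<Pi>\<^sub>M i\<in>UNIV. E))"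
    unfolding point_algebra_def
    by (rule measurable_sigma_vimage_algebra[where F=F, OF _ F_points _ pow])
      (use measurable_space[OF measurable_points] in auto)
  show "l i \<in> borel_measurable point_algebra"
    unfolding point_algebra_def
    by (rule measurable_sigma_vimage_algebra[where F=F, OF _ F_marks _ pow]) auto
qed

text \<open>The marks are averaged out in the product over \<open>i < N\<close>, given the whole
  enumeration; as \<open>N\<close> grows, the unmarked functional of the averaged weight
  \<open>h\<close> remains. Measurability is proved for \<open>point_algebra\<close> rather than
  \<open>M\<close>, since this is what makes products over initial points and over births
  independent.\<close>

lemma
  fixes w :: "'e \<times> real \<Rightarrow> real"
  assumes D: "D \<in> sets E" "D \<in> localizing_ring E C"
    and w[measurable]: "w \<in> borel_measurable (E \<Otimes>\<^sub>M borel)"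
    and w01: "\<And>y. 0 \<le> w y \<and> w y \<le> 1" and w_outside: "\<And>y r. y \<notin> D \<Longrightarrow> w (y, r) = 1"
  shows measurable_marked_prod:
      "(\<lambda>\<omega>. \<Prod>i\<in>points_in D \<omega>. w (x i \<omega>, l i \<omega>)) \<in> borel_measurable point_algebra"
    and marked_pgfl:
      "emeasure \<Lambda> D < \<infinity> \<Longrightarrow> (\<And>i y. expectation (\<lambda>\<omega>. w (y, l i \<omega>)) = h y) \<Longrightarrow>
      expectation (\<lambda>\<omega>. \<Prod>i\<in>points_in D \<omega>. w (x i \<omega>, l i \<omega>)) =
      exp (- (\<integral>y. (1 - h y) * indicator D y \<partial>\<Lambda>))"
proof -
  let ?S = "count_space UNIV \<Otimes>\<^sub>M (\<Pi>\<^sub>M i\<in>(UNIV::nat set). E) :: (enat \<times> (nat \<Rightarrow> 'e)) measure"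
  define V where "V \<omega> = (\<kappa> \<omega>, \<lambda>i. x i \<omega>)" for \<omega>
  \<comment> \<open>The factor of the i-th enumerated point as a function of configuration and mark,
    with value 1 at dummy indices.\<close>
  define W where "W i y = (if enat i < fst (fst y) then w (snd (fst y) i, snd y) else 1)"
    for i and y :: "(enat \<times> (nat \<Rightarrow> 'e)) \<times> real"
  have W[measurable]: "W i \<in> borel_measurable (?S \<Otimes>\<^sub>M borel)" for i unfolding W_def by measurable
  have W01: "0 \<le> W i y \<and> W i y \<le> 1" for i y unfolding W_def using w01 by auto
  have W_V: "W i (V \<omega>, r) = (if enat i < \<kappa> \<omega> then w (x i \<omega>, r) else 1)" for i \<omega> r
    by (simp add: W_def V_def)
  have lim: "(\<lambda>N. \<Prod>i<N. W i (V \<omega>, l i \<omega>)) \<longlonglongrightarrow> (\<Prod>i\<in>points_in D \<omega>. w (x i \<omega>, l i \<omega>))"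
    if "\<omega> \<in> space M" for \<omega>
    unfolding W_V by (rule partial_prods_tendsto[OF that D]) (simp add: w_outside)
  have [measurable]: "V \<in> measurable point_algebra ?S" "l i \<in> borel_measurable point_algebra" for i
    unfolding V_def by (rule measurable_point_algebra)+
  show meas: "(\<lambda>\<omega>. \<Prod>i\<in>points_in D \<omega>. w (x i \<omega>, l i \<omega>)) \<in> borel_measurable point_algebra"
    by (rule borel_measurable_LIMSEQ_real[OF lim]) (auto simp: space_point_algebra)
  assume fin: "emeasure \<Lambda> D < \<infinity>" and h: "\<And>i y. expectation (\<lambda>\<omega>. w (y, l i \<omega>)) = h y"
  \<comment> \<open>The average is the same for every mark, so index 0 serves to read off the
    properties of \<open>h\<close>.\<close>
  have h01: "0 \<le> h y \<and> h y \<le> 1" for y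
    unfolding h[symmetric, of _ 0] using abs_expectation_le_1[of "\<lambda>\<omega>. w (y, l 0 \<omega>)"] w01
    by (auto simp: abs_of_nonneg intro!: integral_nonneg)
  have h_outside: "h y = 1" if "y \<notin> D" for y
    unfolding h[symmetric, of _ 0] using that by (simp add: w_outside prob_space)
  have [measurable]: "h \<in> borel_measurable E"
  proof -
    have "(\<lambda>y. expectation (\<lambda>\<omega>. w (y, l 0 \<omega>))) \<in> borel_measurable E"
      by (rule borel_measurable_lebesgue_integral) measurable
    then show ?thesis unfolding h .
  qed
  have [measurable]: "V \<in> measurable M ?S" unfolding V_def by (rule measurable_points)
  have meas_M: "(\<lambda>\<omega>. \<Prod>i\<in>points_in D \<omega>. w (x i \<omega>, l i \<omega>)) \<in> borel_measurable M"
    by (rule measurable_group[OF indep meas[unfolded point_algebra_def]])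
  have marks: "expectation (\<lambda>\<omega>. \<Prod>i<N. W i (V \<omega>, l i \<omega>)) =
      expectation (\<lambda>\<omega>. \<Prod>i<N. if enat i < \<kappa> \<omega> then h (x i \<omega>) else 1)" for N
  proof -
    have "expectation (\<lambda>\<omega>. 1 * (\<Prod>i<N. W i (V \<omega>, l i \<omega>))) =
      expectation (\<lambda>\<omega>. 1 * (\<Prod>i<N. expectation (\<lambda>\<omega>'. W i (V \<omega>, l i \<omega>'))))"
    proof (rule expectation_prod_independent_marks[OF indep L F_points[folded V_def] F_marks stable])
      show "\<bar>W i y\<bar> \<le> 1" for i y using W01[of i y] by simp
    qed auto
    moreover have "expectation (\<lambda>\<omega>'. W i (V \<omega>, l i \<omega>')) = (if enat i < \<kappa> \<omega> then h (x i \<omega>) else 1)" for i \<omega>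
      by (simp add: W_V h prob_space)
    ultimately show ?thesis by simp
  qed
  have "(\<lambda>N. expectation (\<lambda>\<omega>. \<Prod>i<N. W i (V \<omega>, l i \<omega>))) \<longlonglongrightarrow>
      expectation (\<lambda>\<omega>. \<Prod>i\<in>points_in D \<omega>. w (x i \<omega>, l i \<omega>))"
  proof (rule integral_dominated_convergence[where w="\<lambda>_. 1"])
    show "AE \<omega> in M. norm (\<Prod>i<N. W i (V \<omega>, l i \<omega>)) \<le> 1" for N
      unfolding real_norm_def using W01 by (intro AE_I2 abs_prod_le_1) (simp add: abs_of_nonneg)
  qed (use lim meas_M in auto)
  moreover have "(\<lambda>N. expectation (\<lambda>\<omega>. \<Prod>i<N. if enat i < \<kappa> \<omega> then h (x i \<omega>) else 1)) \<longlonglongrightarrow>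
      expectation (\<lambda>\<omega>. \<Prod>i\<in>points_in D \<omega>. h (x i \<omega>))"
  proof (rule integral_dominated_convergence[where w="\<lambda>_. 1"])
    show "AE \<omega> in M. (\<lambda>N. \<Prod>i<N. if enat i < \<kappa> \<omega> then h (x i \<omega>) else 1) \<longlonglongrightarrow>
        (\<Prod>i\<in>points_in D \<omega>. h (x i \<omega>))"
      by (intro AE_I2 partial_prods_tendsto[OF _ D]) (auto simp: h_outside)
    show "AE \<omega> in M. norm (\<Prod>i<N. if enat i < \<kappa> \<omega> then h (x i \<omega>) else 1) \<le> 1" for N
      unfolding real_norm_def using h01 by (intro AE_I2 abs_prod_le_1) (simp add: abs_of_nonneg)
  qed (use D in \<open>auto intro!: measurable_prod_points_in\<close>)
  ultimately have "expectation (\<lambda>\<omega>. \<Prod>i\<in>points_in D \<omega>. w (x i \<omega>, l i \<omega>)) =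
      expectation (\<lambda>\<omega>. \<Prod>i\<in>points_in D \<omega>. h (x i \<omega>))"
    unfolding marks by (rule LIMSEQ_unique)
  also have "\<dots> = exp (- (\<integral>y. (1 - h y) * indicator D y \<partial>\<Lambda>))"
    by (rule pgfl[OF D fin _ h01]) measurable
  finally show "expectation (\<lambda>\<omega>. \<Prod>i\<in>points_in D \<omega>. w (x i \<omega>, l i \<omega>)) =
      exp (- (\<integral>y. (1 - h y) * indicator D y \<partial>\<Lambda>))" .
qed

end

subsection \<open>Stationarity of pairs\<close>

text \<open>As a series of indicators, the cardinality of a random index set is visibly
  measurable.\<close>

lemma emeasure_count_space_Collect_nat:
  "emeasure (count_space UNIV) {i::nat. P i} = (\<Sum>i. if P i then 1 else 0)"
proof -
  have "emeasure (count_space UNIV) {i::nat. P i} = (\<integral>\<^sup>+i. indicator {i. P i} i \<partial>count_space UNIV)" by simp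
  also have "\<dots> = (\<Sum>i. indicator {i. P i} i)" by (rule nn_integral_count_space_nat)
  finally show ?thesis by (simp add: indicator_def of_bool_def)
qed

lemma measurable_emeasure_count_space_nat:
  assumes [measurable]: "\<And>i. Measurable.pred M (P i)"
  shows "(\<lambda>\<omega>. emeasure (count_space UNIV) {i::nat. P i \<omega>}) \<in> borel_measurable M"
  unfolding emeasure_count_space_Collect_nat by measurable

text \<open>Needed because \<open>\<eta>\<close> agrees with the sum of Dirac measures only on
  \<open>space M\<close>.\<close>

lemma poisson_process_cong:
  assumes eq: "\<And>\<omega>. \<omega> \<in> space M \<Longrightarrow> \<Phi> \<omega> = \<Psi> \<omega>" and "prob_space M" and "poisson_process M X B \<Lambda> \<Phi>"
  shows "poisson_process M X B \<Lambda> \<Psi>"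
proof -
  interpret prob_space M by fact
  have P: "\<Phi> \<in> measurable M (counting_measure_space X B)"
    "\<And>A. A \<in> sets X \<Longrightarrow> poisson_variable M (\<lambda>\<omega>. emeasure (\<Phi> \<omega>) A) (emeasure \<Lambda> A)"
    "\<And>A :: nat \<Rightarrow> _. range A \<subseteq> sets X \<Longrightarrow> disjoint_family A \<Longrightarrow>
      indep_vars (\<lambda>_. borel) (\<lambda>i \<omega>. emeasure (\<Phi> \<omega>) (A i)) UNIV"
    using assms(3) unfolding poisson_process_def by auto
  have "\<Psi> \<in> measurable M (counting_measure_space X B)"
    using P(1) eq by (simp cong: measurable_cong)
  moreover have "poisson_variable M (\<lambda>\<omega>. emeasure (\<Psi> \<omega>) A) m"
    if "poisson_variable M (\<lambda>\<omega>. emeasure (\<Phi> \<omega>) A) m" for A m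
    using that eq unfolding poisson_variable_def by (auto cong: AE_cong conj_cong)
  moreover have "indep_vars (\<lambda>_. borel) (\<lambda>i \<omega>. emeasure (\<Psi> \<omega>) (A i)) UNIV"
    if "indep_vars (\<lambda>_. borel) (\<lambda>i \<omega>. emeasure (\<Phi> \<omega>) (A i)) UNIV" for A :: "nat \<Rightarrow> _"
  proof -
    have "(\<lambda>\<omega>. emeasure (\<Psi> \<omega>) (A i)) -` S \<inter> space M = (\<lambda>\<omega>. emeasure (\<Phi> \<omega>) (A i)) -` S \<inter> space M" for i S
      using eq by auto
    moreover have "random_variable borel (\<lambda>\<omega>. emeasure (\<Psi> \<omega>) (A i)) \<longleftrightarrow>
        random_variable borel (\<lambda>\<omega>. emeasure (\<Phi> \<omega>) (A i))" for i
      using eq by (intro measurable_cong) simp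
    ultimately show ?thesis using that unfolding indep_vars_def2 by simp
  qed
  ultimately show ?thesis using P unfolding poisson_process_def by auto
qed

section \<open>Contribution of a single point at two times\<close>

lemma has_bochner_integral_exp_Ioc:
  fixes c d :: real assumes "c \<le> d"
  shows "has_bochner_integral lborel (\<lambda>r. exp r * indicator {c<..d} r) (exp d - exp c)"
proof -
  have "has_bochner_integral lborel (\<lambda>r. exp r * indicator {c..d} r) (exp d - exp c)"
    using assms by (intro has_bochner_integral_FTC_Icc_real) (auto intro!: derivative_eq_intros)
  also have "?this \<longleftrightarrow> has_bochner_integral lborel (\<lambda>r. exp r * indicator {c<..d} r) (exp d - exp c)"
  proof (rule has_bochner_integral_cong_AE)
    show "AE r in lborel. exp r * indicator {c..d} r = exp r * (indicator {c<..d} r :: real)"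
      using AE_lborel_singleton[of c] by eventually_elim (auto simp: indicator_def)
  qed auto
  finally show ?thesis .
qed

text \<open>\<open>r\<close> is the birth time, 0 for initial points, and \<open>s\<close> the
  lifetime.\<close>

definition alive :: "real \<Rightarrow> real \<Rightarrow> real \<Rightarrow> bool" where
  "alive t r s \<longleftrightarrow> r \<le> t \<and> t < r + s"

text \<open>
  One minus the expectation of the product of \<open>p\<close>, if a point born at time \<open>r\<close> is alive at time
  \<open>a\<close>, and \<open>q\<close>, if it is alive at time \<open>b\<close>.
\<close>

definition loss :: "real \<Rightarrow> real \<Rightarrow> real \<Rightarrow> real \<Rightarrow> real \<Rightarrow> real" where
  "loss a b p q r = of_bool (r \<le> a) * ((1 - p) * exp (r - a))
    + of_bool (r \<le> b) * ((if r \<le> a then p else 1) * (1 - q) * exp (r - b))"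

text \<open>Each of the two summands lies in [0,1]. The crude bound 2 only has to provide
  integrability over the window.\<close>

lemma loss_bounds:
  assumes "a \<le> b" "0 \<le> p" "p \<le> 1" "0 \<le> q" "q \<le> 1"
  shows "0 \<le> loss a b p q r" "loss a b p q r \<le> 2"
proof -
  have *: "0 \<le> of_bool P * (y * exp e) \<and> of_bool P * (y * exp e) \<le> 1"
    if "0 \<le> y" "y \<le> 1" "P \<Longrightarrow> e \<le> 0" for P y and e :: real
    using that by (auto intro!: mult_le_one)
  have "0 \<le> (if r \<le> a then p else 1) * (1 - q)" "(if r \<le> a then p else 1) * (1 - q) \<le> 1"
    using assms by (auto intro!: mult_le_one)
  from *[OF this, of "r \<le> b" "r - b"] *[of "1 - p" "r \<le> a" "r - a"] assms
  show "0 \<le> loss a b p q r" "loss a b p q r \<le> 2"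
    unfolding loss_def by (auto simp del: of_bool_eq)
qed

lemma (in prob_space) expectation_alive:
  assumes L: "distributed M lborel L (exponential_density 1)" and ab: "0 \<le> a" "a \<le> b" and r: "0 \<le> r"
  shows "expectation (\<lambda>\<omega>. (if alive a r (L \<omega>) then p else 1) * (if alive b r (L \<omega>) then q else 1)) =
    1 - loss a b p q r"
proof -
  have [measurable]: "L \<in> borel_measurable M" using distributed_measurable[OF L] by simp
  have tail: "expectation (\<lambda>\<omega>. of_bool (t < L \<omega>)) = exp (- t)" if "0 \<le> t" for t
  proof -
    have "expectation (\<lambda>\<omega>. of_bool (t < L \<omega>)) = expectation (indicator {\<omega> \<in> space M. t < L \<omega>})"
      by (intro Bochner_Integration.integral_cong) (auto simp: indicator_def)
    also have "\<dots> = prob {\<omega> \<in> space M. t < L \<omega>}"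
      by (subst Bochner_Integration.integral_indicator) (auto intro!: arg_cong[where f=prob])
    also have "\<dots> = exp (- t)" using exponential_distributedD_gt[OF L that] by simp
    finally show ?thesis .
  qed
  have [simp]: "integrable M (\<lambda>\<omega>. of_bool (t < L \<omega>) :: real)" for t
    by (intro integrable_const_bound[where B=1]) auto
  consider "r \<le> a" | "a < r" "r \<le> b" | "b < r" by linarith
  then show ?thesis
  proof cases
    case 1
    \<comment> \<open>A point born by time \<open>a\<close> whose lifetime exceeds
      \<open>b - r\<close> also survives \<open>a - r\<close>. So the product is 1, \<open>p\<close>
      or \<open>p * q\<close>, and the two tail indicators account for the successive drops.\<close>
    have "expectation (\<lambda>\<omega>. (if alive a r (L \<omega>) then p else 1) * (if alive b r (L \<omega>) then q else 1)) =
      expectation (\<lambda>\<omega>. 1 - (1 - p) * of_bool (a - r < L \<omega>) - p * (1 - q) * of_bool (b - r < L \<omega>))"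
      using 1 ab by (intro Bochner_Integration.integral_cong) (auto simp: alive_def algebra_simps)
    also have "\<dots> = 1 - (1 - p) * exp (- (a - r)) - p * (1 - q) * exp (- (b - r))"
      using 1 ab by (simp add: tail prob_space)
    also have "\<dots> = 1 - loss a b p q r" using 1 ab by (simp add: loss_def)
    finally show ?thesis .
  next
    case 2
    have "expectation (\<lambda>\<omega>. (if alive a r (L \<omega>) then p else 1) * (if alive b r (L \<omega>) then q else 1)) =
      expectation (\<lambda>\<omega>. 1 - (1 - q) * of_bool (b - r < L \<omega>))"
      using 2 ab by (intro Bochner_Integration.integral_cong) (auto simp: alive_def algebra_simps)
    also have "\<dots> = 1 - (1 - q) * exp (- (b - r))"
      using 2 ab by (simp add: tail prob_space)
    also have "\<dots> = 1 - loss a b p q r" using 2 ab by (simp add: loss_def)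
    finally show ?thesis .
  next
    case 3
    then show ?thesis using ab by (simp add: alive_def loss_def prob_space)
  qed
qed

text \<open>The cancellation behind stationarity: initial points carry the weight exp(- a), births
  in (0,a] the weight 1 - exp(- a), and the sum no longer depends on \<open>a\<close> except through
  b - a. By b < n, all births up to time \<open>b\<close> are inside the range of
  integration.\<close>

lemma integral_loss:
  assumes "0 \<le> a" "a \<le> b" "b < n"
  shows "loss a b p q 0 + (\<integral>r. loss a b p q r * indicator {0<..<n} r \<partial>pos_time) =
    (1 - p) + p * (1 - q) * exp (a - b) + (1 - q) * (1 - exp (a - b))"
proof -
  have "(\<integral>r. loss a b p q r * indicator {0<..<n} r \<partial>pos_time) =
      (\<integral>r. indicator {0<..} r * (loss a b p q r * indicator {0<..<n} r) \<partial>lborel)"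
    by (subst integral_restrict_space) auto
  \<comment> \<open>Split at \<open>a\<close>: births up to \<open>a\<close> are subject to both
    factors, births in (a,b] only to \<open>q\<close>, later ones to neither.\<close>
  also have "\<dots> = (\<integral>r. ((1 - p) * exp (- a) + p * (1 - q) * exp (- b)) * (exp r * indicator {0<..a} r) +
      ((1 - q) * exp (- b)) * (exp r * indicator {a<..b} r) \<partial>lborel)"
    using assms by (intro Bochner_Integration.integral_cong)
      (auto simp: loss_def indicator_def algebra_simps exp_diff exp_minus divide_simps)
  also have "\<dots> = ((1 - p) * exp (- a) + p * (1 - q) * exp (- b)) * (exp a - exp 0) +
      ((1 - q) * exp (- b)) * (exp b - exp a)"
    using assms by (intro has_bochner_integral_integral_eq has_bochner_integral_add
        has_bochner_integral_mult_right has_bochner_integral_exp_Ioc) auto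
  finally have "loss a b p q 0 + (\<integral>r. loss a b p q r * indicator {0<..<n} r \<partial>pos_time) =
      (1 - p) * exp (- a) + p * (1 - q) * exp (- b) +
      (((1 - p) * exp (- a) + p * (1 - q) * exp (- b)) * (exp a - exp 0) + ((1 - q) * exp (- b)) * (exp b - exp a))"
    using assms by (simp only: loss_def) simp
  also have "\<dots> = (1 - p) * (exp (- a) * exp a) + p * (1 - q) * (exp (- b) * exp a)
      + (1 - q) * (exp (- b) * exp b - exp (- b) * exp a)"
    by (simp add: algebra_simps)
  finally show ?thesis by (simp add: exp_add[symmetric])
qed

section \<open>The birth-and-death process as two independent marked Poisson processes\<close>

locale birth_death = prob_space M for M :: "'w measure" +
  fixes X :: "'a measure" and B :: "nat \<Rightarrow> 'a set" and \<Lambda> :: "'a measure"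
    and \<eta> :: "'w \<Rightarrow> 'a measure" and \<eta>t :: "real \<Rightarrow> 'w \<Rightarrow> 'a measure"
    and \<kappa> :: "'w \<Rightarrow> enat" and x :: "nat \<Rightarrow> 'w \<Rightarrow> 'a" and l :: "nat \<Rightarrow> 'w \<Rightarrow> real"
    and \<kappa>' :: "'w \<Rightarrow> enat" and z :: "nat \<Rightarrow> 'w \<Rightarrow> 'a \<times> real" and l' :: "nat \<Rightarrow> 'w \<Rightarrow> real"
  assumes localizing: "localizing_sequence X B" and locally_finite: "locally_finite_measure X B \<Lambda>"
    and \<kappa>_measurable [measurable]: "\<kappa> \<in> measurable M (count_space UNIV)"
    and \<kappa>'_measurable [measurable]: "\<kappa>' \<in> measurable M (count_space UNIV)"
    and x_measurable [measurable]: "\<And>i. x i \<in> measurable M X"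
    and z_measurable [measurable]: "\<And>j. z j \<in> measurable M (X \<Otimes>\<^sub>M pos_time)"
    and l_exponential: "\<And>i. distributed M lborel (l i) (exponential_density 1)"
    and l'_exponential: "\<And>j. distributed M lborel (l' j) (exponential_density 1)"
    and life_pos: "\<And>\<omega> i. \<omega> \<in> space M \<Longrightarrow> 0 < l i \<omega>"
    and sources_indep: "indep_sets (source_algebra M X \<kappa> x l \<kappa>' z l') UNIV"
    and initial_poisson: "poisson_process M X B \<Lambda> \<eta>"
    and initial: "\<And>\<omega>. \<omega> \<in> space M \<Longrightarrow> \<eta> \<omega> = dirac_sum X {i. enat i < \<kappa> \<omega>} (\<lambda>i. x i \<omega>)"
    and birth_poisson: "poisson_process M (X \<Otimes>\<^sub>M pos_time) (\<lambda>n. B n \<times> {0<..<real n}) (\<Lambda> \<Otimes>\<^sub>M pos_time)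
        (\<lambda>\<omega>. dirac_sum (X \<Otimes>\<^sub>M pos_time) {j. enat j < \<kappa>' \<omega>} (\<lambda>j. z j \<omega>))"
    and evolution: "\<And>t \<omega>. 0 \<le> t \<Longrightarrow> \<omega> \<in> space M \<Longrightarrow> \<eta>t t \<omega> =
          dirac_sum X
            ({i. enat i < \<kappa> \<omega> \<and> t < l i \<omega>} <+>
             {j. enat j < \<kappa>' \<omega> \<and> snd (z j \<omega>) \<le> t \<and> t < snd (z j \<omega>) + l' j \<omega>})
            (case_sum (\<lambda>i. x i \<omega>) (\<lambda>j. fst (z j \<omega>)))"
begin

lemma B_sets: "B n \<in> sets X"
  using localizing by (auto simp: localizing_sequence_def)

lemma sets_\<Lambda>: "sets \<Lambda> = sets X"
  using locally_finite by (simp add: locally_finite_measure_def)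

lemma space_\<Lambda>: "space \<Lambda> = space X"
  by (rule sets_eq_imp_space_eq[OF sets_\<Lambda>])

lemma B_ring: "B n \<in> localizing_ring X B"
  unfolding localizing_ring_def using B_sets[of n] by blast

lemma B_finite: "emeasure \<Lambda> (B n) < \<infinity>"
  using locally_finite B_ring by (auto simp: locally_finite_measure_def)

lemma [measurable]: "l i \<in> borel_measurable M" "l' i \<in> borel_measurable M"
  using l_exponential[THEN distributed_measurable] l'_exponential[THEN distributed_measurable] by auto

lemma sets_pos_time_product: "sets (\<Lambda> \<Otimes>\<^sub>M pos_time) = sets (X \<Otimes>\<^sub>M pos_time)"
  by (rule sets_pair_measure_cong[OF sets_\<Lambda> refl])

lemma measurable_snd_pos_time [measurable]: "snd \<in> borel_measurable (X \<Otimes>\<^sub>M pos_time)"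
  by (rule measurable_compose[OF measurable_snd]) (auto intro: measurable_restrict_space1)

lemma window_sets: "B n \<times> {0<..<real n} \<in> sets (X \<Otimes>\<^sub>M pos_time)"
  by (intro pair_measureI B_sets) (auto simp: sets_restrict_space_iff)

lemma window_ring: "B n \<times> {0<..<real n} \<in> localizing_ring (X \<Otimes>\<^sub>M pos_time) (\<lambda>n. B n \<times> {0<..<real n})"
  unfolding localizing_ring_def using window_sets[of n] by blast

lemma source_algebra_stable: "Int_stable (source_algebra M X \<kappa> x l \<kappa>' z l' s)"
  unfolding source_algebra_def by (auto simp: Int_stable_def split: source.split)

sublocale initials: marked_poisson_process M X B \<Lambda> \<kappa> x "source_algebra M X \<kappa> x l \<kappa>' z l'"
  Initial_Points Initial_Life l
proof
  show "poisson_process M X B \<Lambda> (\<lambda>\<omega>. dirac_sum X {i. enat i < \<kappa> \<omega>} (\<lambda>i. x i \<omega>))"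
    by (rule poisson_process_cong[OF initial prob_space_axioms initial_poisson])
qed (auto simp: sets_\<Lambda> inj_def intro: sources_indep source_algebra_stable, simp_all add: source_algebra_def)

sublocale births: marked_poisson_process M "X \<Otimes>\<^sub>M pos_time" "\<lambda>n. B n \<times> {0<..<real n}" "\<Lambda> \<Otimes>\<^sub>M pos_time" \<kappa>' z
  "source_algebra M X \<kappa> x l \<kappa>' z l'" Birth_Points Birth_Life l'
  by standard
    (auto simp: sets_pos_time_product inj_def intro: birth_poisson sources_indep source_algebra_stable,
      simp_all add: source_algebra_def)

sublocale intensity: sigma_finite_measure \<Lambda>
proof
  show "\<exists>A. countable A \<and> A \<subseteq> sets \<Lambda> \<and> \<Union>A = space \<Lambda> \<and> (\<forall>a\<in>A. emeasure \<Lambda> a \<noteq> \<infinity>)"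
    using localizing B_sets B_finite
    by (intro exI[of _ "range B"]) (auto simp: sets_\<Lambda> space_\<Lambda> localizing_sequence_def less_top)
qed

sublocale pos_time: sigma_finite_measure pos_time
  by (rule sigma_finite_measure_restrict_space) (auto intro: sigma_finite_lborel)

sublocale intensity_time: pair_sigma_finite \<Lambda> pos_time ..

lemma window_finite: "emeasure (\<Lambda> \<Otimes>\<^sub>M pos_time) (B n \<times> {0<..<real n}) < \<infinity>"
proof -
  have "emeasure (\<Lambda> \<Otimes>\<^sub>M pos_time) (B n \<times> {0<..<real n}) = emeasure \<Lambda> (B n) * emeasure pos_time {0<..<real n}"
    by (intro pos_time.emeasure_pair_measure_Times) (auto simp: sets_\<Lambda> B_sets sets_restrict_space_iff)
  also have "emeasure pos_time {0<..<real n} = ennreal (real n)"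
    by (subst emeasure_restrict_space) auto
  finally show ?thesis using B_finite[of n] by (simp add: ennreal_mult_less_top)
qed

definition survivors :: "real \<Rightarrow> 'a set \<Rightarrow> 'w \<Rightarrow> nat set" where
  "survivors t A \<omega> = {i. enat i < \<kappa> \<omega> \<and> x i \<omega> \<in> A \<and> alive t 0 (l i \<omega>)}"

definition newborns :: "real \<Rightarrow> 'a set \<Rightarrow> 'w \<Rightarrow> nat set" where
  "newborns t A \<omega> = {j. enat j < \<kappa>' \<omega> \<and> fst (z j \<omega>) \<in> A \<and> alive t (snd (z j \<omega>)) (l' j \<omega>)}"

lemma z_space: "\<omega> \<in> space M \<Longrightarrow> fst (z j \<omega>) \<in> space X \<and> 0 < snd (z j \<omega>)"
  using measurable_space[OF z_measurable, of \<omega> j] by (auto simp: space_pair_measure space_restrict_space)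

lemma emeasure_\<eta>t:
  assumes "0 \<le> t" "\<omega> \<in> space M" "A \<in> sets X"
  shows "emeasure (\<eta>t t \<omega>) A =
    emeasure (count_space UNIV) (survivors t A \<omega>) + emeasure (count_space UNIV) (newborns t A \<omega>)"
proof -
  let ?I = "{i. enat i < \<kappa> \<omega> \<and> t < l i \<omega>} <+>
             {j. enat j < \<kappa>' \<omega> \<and> snd (z j \<omega>) \<le> t \<and> t < snd (z j \<omega>) + l' j \<omega>}"
  let ?p = "case_sum (\<lambda>i. x i \<omega>) (\<lambda>j. fst (z j \<omega>))"
  have "emeasure (\<eta>t t \<omega>) A = emeasure (count_space UNIV) {i\<in>?I. ?p i \<in> A}"
    unfolding evolution[OF assms(1,2)]
    using assms z_space measurable_space[OF x_measurable assms(2)] by (intro emeasure_dirac_sum) auto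
  also have "{i\<in>?I. ?p i \<in> A} = Inl ` survivors t A \<omega> \<union> Inr ` newborns t A \<omega>"
    using assms(1) by (auto simp: survivors_def newborns_def alive_def)
  also have "emeasure (count_space UNIV) \<dots> =
      emeasure (count_space UNIV) (Inl ` survivors t A \<omega> :: (nat + nat) set) +
      emeasure (count_space UNIV) (Inr ` newborns t A \<omega> :: (nat + nat) set)"
    by (intro plus_emeasure[symmetric]) auto
  also have "emeasure (count_space UNIV) (Inl ` survivors t A \<omega> :: (nat + nat) set) =
      emeasure (count_space UNIV) (survivors t A \<omega>)"
    by (simp add: emeasure_count_space finite_image_iff card_image)
  also have "emeasure (count_space UNIV) (Inr ` newborns t A \<omega> :: (nat + nat) set) =
      emeasure (count_space UNIV) (newborns t A \<omega>)"
    by (simp add: emeasure_count_space finite_image_iff card_image)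
  finally show ?thesis .
qed

lemma survivors_eq: "A \<subseteq> D \<Longrightarrow>
    survivors t A \<omega> = {i \<in> initials.points_in D \<omega>. x i \<omega> \<in> A \<and> alive t 0 (l i \<omega>)}"
  by (auto simp: survivors_def initials.points_in_def)

text \<open>A point alive at time t < n was born in (0,t], hence inside the window, where there are
  only finitely many births.\<close>

lemma newborns_eq: "A \<subseteq> B n \<Longrightarrow> t < real n \<Longrightarrow> \<omega> \<in> space M \<Longrightarrow>
    newborns t A \<omega> =
      {j \<in> births.points_in (B n \<times> {0<..<real n}) \<omega>. fst (z j \<omega>) \<in> A \<and> alive t (snd (z j \<omega>)) (l' j \<omega>)}"
  using z_space by (auto simp: newborns_def births.points_in_def alive_def mem_Times_iff subset_iff)

text \<open>A single index has to bound finitely many sets in space and also the time horizon,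
  because the localizing sequence for births uses the same \<open>n\<close> for both.\<close>

lemma window_exists:
  assumes "finite \<A>" "\<A> \<subseteq> localizing_ring X B"
  obtains n where "\<And>A. A \<in> \<A> \<Longrightarrow> A \<subseteq> B n" "t < real n"
proof -
  have "\<exists>n. (\<forall>A\<in>\<A>. A \<subseteq> B n) \<and> t < real n"
    using assms
  proof (induction \<A>)
    case empty
    then show ?case using reals_Archimedean2 by auto
  next
    case (insert A \<A>)
    then obtain n where n: "\<forall>A\<in>\<A>. A \<subseteq> B n" "t < real n" by auto
    obtain m where m: "A \<subseteq> B m" using insert.prems by (auto simp: localizing_ring_def)
    have "incseq B" using localizing by (simp add: localizing_sequence_def)
    then have "B n \<subseteq> B (max m n)" "B m \<subseteq> B (max m n)" by (simp_all add: incseq_def)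
    moreover have "t < real (max m n)" using n(2) by simp
    ultimately show ?case using n(1) m by (intro exI[of _ "max m n"]) (simp, meson order_trans)
  qed
  then show ?thesis using that by auto
qed

lemma ring_sets: "A \<in> localizing_ring X B \<Longrightarrow> A \<in> sets X"
  using B_sets by (auto simp: localizing_ring_def)

lemma finite_survivors_newborns:
  assumes "\<omega> \<in> space M" "A \<in> localizing_ring X B"
  shows "finite (survivors t A \<omega>)" "finite (newborns t A \<omega>)"
proof -
  obtain n where n: "A \<subseteq> B n" "t < real n" using window_exists[of "{A}" t] assms(2) by auto
  show "finite (survivors t A \<omega>)"
    unfolding survivors_eq[OF n(1)] using initials.finite_points_in[OF assms(1) B_sets B_ring] by simp
  show "finite (newborns t A \<omega>)"
    unfolding newborns_eq[OF n assms(1)] using births.finite_points_in[OF assms(1) window_sets window_ring] by simp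
qed

text \<open>Meaningful for \<open>A\<close> in the localizing ring, where both index sets are
  finite; \<open>card\<close> would be 0 on an infinite set.\<close>

definition population :: "real \<Rightarrow> 'a set \<Rightarrow> 'w \<Rightarrow> nat" where
  "population t A \<omega> = card (survivors t A \<omega>) + card (newborns t A \<omega>)"

lemma emeasure_\<eta>t_population:
  assumes "0 \<le> t" "\<omega> \<in> space M" "A \<in> localizing_ring X B"
  shows "emeasure (\<eta>t t \<omega>) A = of_nat (population t A \<omega>)"
  using finite_survivors_newborns[OF assms(2,3)] assms
  by (simp add: emeasure_\<eta>t ring_sets emeasure_count_space population_def)

lemma \<eta>t_counting_measures:
  assumes "0 \<le> t" "\<omega> \<in> space M"
  shows "\<eta>t t \<omega> \<in> counting_measures X B"
  using emeasure_\<eta>t_population[OF assms] evolution[OF assms]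
  by (auto simp: counting_measures_def dirac_sum_def)

text \<open>Positive lifetimes keep every initial point alive at time 0, and positive birth times
  exclude newborns. This connects the construction with the \<open>\<eta>\<close> of the covariance
  hypothesis.\<close>

lemma \<eta>t_0: "\<omega> \<in> space M \<Longrightarrow> \<eta>t 0 \<omega> = \<eta> \<omega>"
proof (rule measure_eqI)
  fix A assume \<omega>: "\<omega> \<in> space M" and "A \<in> sets (\<eta>t 0 \<omega>)"
  then have A: "A \<in> sets X" by (simp add: evolution dirac_sum_def)
  have "newborns 0 A \<omega> = {}" using z_space[OF \<omega>] by (auto simp: newborns_def alive_def not_le)
  moreover have "survivors 0 A \<omega> = initials.points_in A \<omega>"
    using life_pos[OF \<omega>] by (auto simp: survivors_def initials.points_in_def alive_def)
  ultimately show "emeasure (\<eta>t 0 \<omega>) A = emeasure (\<eta> \<omega>) A"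
    using A \<omega> by (simp add: emeasure_\<eta>t initial initials.emeasure_points)
qed (simp add: evolution initial dirac_sum_def)

lemma measurable_emeasure_\<eta>t:
  assumes "0 \<le> t" and [measurable]: "A \<in> sets X"
  shows "(\<lambda>\<omega>. emeasure (\<eta>t t \<omega>) A) \<in> borel_measurable M"
proof -
  have "(\<lambda>\<omega>. emeasure (count_space UNIV) (survivors t A \<omega>) + emeasure (count_space UNIV) (newborns t A \<omega>))
      \<in> borel_measurable M"
    unfolding survivors_def newborns_def alive_def
    by (intro borel_measurable_add measurable_emeasure_count_space_nat) measurable
  then show ?thesis using assms by (simp add: emeasure_\<eta>t cong: measurable_cong)
qed

end

section \<open>Joint generating function of the counts at two times\<close>

lemma power_card_Collect:
  fixes s :: real
  assumes "finite P" shows "s ^ card {i\<in>P. Q i} = (\<Prod>i\<in>P. if Q i then s else 1)"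
  using assms by (simp add: prod.inter_filter[symmetric])

context birth_death
begin

lemma measurable_population:
  assumes "0 \<le> t" "A \<in> localizing_ring X B"
  shows "population t A \<in> measurable M (count_space UNIV)"
proof -
  have "(\<lambda>\<omega>. nat \<lfloor>enn2real (emeasure (\<eta>t t \<omega>) A)\<rfloor>) \<in> measurable M (count_space UNIV)"
    using measurable_emeasure_\<eta>t[OF assms(1) ring_sets[OF assms(2)]] by measurable
  then show ?thesis
    using emeasure_\<eta>t_population[OF assms(1) _ assms(2)] by (simp cong: measurable_cong)
qed

text \<open>The index sets on the right are the same for all admissible \<open>A\<close> and
  \<open>t\<close>, so powers belonging to several sets and times can be multiplied point by
  point.\<close>

lemma power_population:
  fixes s :: real
  assumes \<omega>: "\<omega> \<in> space M" and A: "A \<subseteq> B n" "t < real n"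
  shows "s ^ population t A \<omega> =
    (\<Prod>i\<in>initials.points_in (B n) \<omega>. if x i \<omega> \<in> A \<and> alive t 0 (l i \<omega>) then s else 1) *
    (\<Prod>j\<in>births.points_in (B n \<times> {0<..<real n}) \<omega>.
      if fst (z j \<omega>) \<in> A \<and> alive t (snd (z j \<omega>)) (l' j \<omega>) then s else 1)"
  unfolding population_def power_add survivors_eq[OF A(1)] newborns_eq[OF A \<omega>]
  by (simp only: power_card_Collect initials.finite_points_in[OF \<omega> B_sets B_ring]
      births.finite_points_in[OF \<omega> window_sets window_ring])

text \<open>The first two summands belong to the points present at the earlier time, which survive
  the lag \<delta> with probability exp(- \<delta>); the last belongs to an independent Poisson
  process of intensity (1 - exp(- \<delta>)) \<Lambda>.\<close>

definition stationary_loss :: "real \<Rightarrow> real \<Rightarrow> real \<Rightarrow> real" where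
  "stationary_loss \<delta> p q = (1 - p) + p * (1 - q) * exp (- \<delta>) + (1 - q) * (1 - exp (- \<delta>))"

text \<open>Fubini separates location from birth time, and \<open>integral_loss\<close> applies at
  each location because \<open>u\<close> and \<open>v\<close> depend on the location alone.\<close>

lemma integral_loss_total:
  assumes ab: "0 \<le> a" "a \<le> b" "b < real n"
    and [measurable]: "u \<in> borel_measurable X" "v \<in> borel_measurable X"
    and uv: "\<And>y. 0 \<le> u y \<and> u y \<le> 1" "\<And>y. 0 \<le> v y \<and> v y \<le> 1"
  shows "(\<integral>y. loss a b (u y) (v y) 0 * indicator (B n) y \<partial>\<Lambda>) +
    (\<integral>y. loss a b (u (fst y)) (v (fst y)) (snd y) * indicator (B n \<times> {0<..<real n}) y \<partial>(\<Lambda> \<Otimes>\<^sub>M pos_time)) =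
    (\<integral>y. stationary_loss (b - a) (u y) (v y) * indicator (B n) y \<partial>\<Lambda>)"
proof -
  note [measurable_cong] = sets_\<Lambda>
  note [measurable] = B_sets window_sets
  have bound: "\<bar>loss a b (u y) (v y) r\<bar> \<le> 2" for y r
    using loss_bounds[OF ab(2), of "u y" "v y" r] uv by simp
  have snd_borel[measurable]: "snd \<in> borel_measurable (\<Lambda> \<Otimes>\<^sub>M pos_time)"
    by (rule measurable_compose[OF measurable_snd]) (auto intro: measurable_restrict_space1)
  have W: "B n \<times> {0<..<real n} \<in> sets (\<Lambda> \<Otimes>\<^sub>M pos_time)"
    unfolding sets_pos_time_product by (rule window_sets)
  let ?g = "\<lambda>y. loss a b (u (fst y)) (v (fst y)) (snd y) * indicator (B n \<times> {0<..<real n}) y"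
  have int: "integrable (\<Lambda> \<Otimes>\<^sub>M pos_time) ?g"
  proof (rule Bochner_Integration.integrable_bound[of _ "\<lambda>y. 2 * indicator (B n \<times> {0<..<real n}) y :: real"])
    show "integrable (\<Lambda> \<Otimes>\<^sub>M pos_time) (\<lambda>y. 2 * indicator (B n \<times> {0<..<real n}) y :: real)"
      using W window_finite[of n] by simp
    show "?g \<in> borel_measurable (\<Lambda> \<Otimes>\<^sub>M pos_time)"
      using W unfolding loss_def by measurable
    show "AE y in \<Lambda> \<Otimes>\<^sub>M pos_time. norm (?g y) \<le> norm (2 * indicator (B n \<times> {0<..<real n}) y :: real)"
      using bound by (intro AE_I2) (auto simp: indicator_def)
  qed
  have int0: "integrable \<Lambda> (\<lambda>y. loss a b (u y) (v y) 0 * indicator (B n) y)"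
  proof (rule Bochner_Integration.integrable_bound[of _ "\<lambda>y. 2 * indicator (B n) y :: real"])
    show "integrable \<Lambda> (\<lambda>y. 2 * indicator (B n) y :: real)"
      using B_finite[of n] B_sets by (simp add: sets_\<Lambda>)
    show "(\<lambda>y. loss a b (u y) (v y) 0 * indicator (B n) y) \<in> borel_measurable \<Lambda>"
      unfolding loss_def by measurable
    show "AE y in \<Lambda>. norm (loss a b (u y) (v y) 0 * indicator (B n) y) \<le> norm (2 * indicator (B n) y :: real)"
      using bound by (intro AE_I2) (auto simp: indicator_def)
  qed
  have "(\<integral>y. ?g y \<partial>(\<Lambda> \<Otimes>\<^sub>M pos_time)) = (\<integral>y. \<integral>r. ?g (y, r) \<partial>pos_time \<partial>\<Lambda>)"
    by (rule intensity_time.integral_fst'[OF int, symmetric])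
  then have "(\<integral>y. loss a b (u y) (v y) 0 * indicator (B n) y \<partial>\<Lambda>) + (\<integral>y. ?g y \<partial>(\<Lambda> \<Otimes>\<^sub>M pos_time)) =
      (\<integral>y. loss a b (u y) (v y) 0 * indicator (B n) y + (\<integral>r. ?g (y, r) \<partial>pos_time) \<partial>\<Lambda>)"
    using intensity_time.integrable_fst'[OF int] int0 by simp
  also have "\<dots> = (\<integral>y. stationary_loss (b - a) (u y) (v y) * indicator (B n) y \<partial>\<Lambda>)"
  proof (rule Bochner_Integration.integral_cong[OF refl])
    fix y
    show "loss a b (u y) (v y) 0 * indicator (B n) y + (\<integral>r. ?g (y, r) \<partial>pos_time) =
        stationary_loss (b - a) (u y) (v y) * indicator (B n) y"
    proof (cases "y \<in> B n")
      case True
      then have "indicator (B n \<times> {0<..<real n}) (y, r) = (indicator {0<..<real n} r :: real)" for r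
        by (simp add: indicator_def)
      then show ?thesis
        using integral_loss[OF ab, of "u y" "v y"] True by (simp add: stationary_loss_def)
    qed (simp add: indicator_def)
  qed
  finally show ?thesis .
qed

text \<open>In an index \<open>j\<close>, the Boolean selects the time (\<open>a\<close> if true),
  and the other components are a set and a prescribed count, as in \<open>count_cylinder\<close>
  below. The two products on the right are the factors of a point at \<open>y\<close> that is alive
  at the earlier and at the later time. The times enter the right side only through
  \<open>b - a\<close>.\<close>

lemma pgf_population:
  fixes S :: "(bool \<times> 'a set \<times> nat) set" and s :: "bool \<times> 'a set \<times> nat \<Rightarrow> real"
  assumes ab: "0 \<le> a" "a \<le> b" "b < real n" and "finite S"
    and S: "\<And>j. j \<in> S \<Longrightarrow> fst (snd j) \<in> localizing_ring X B" "\<And>j. j \<in> S \<Longrightarrow> fst (snd j) \<subseteq> B n"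
    and s: "\<And>j. 0 < s j \<and> s j < 1"
  shows "expectation (\<lambda>\<omega>. \<Prod>j\<in>S. s j ^ population (if fst j then a else b) (fst (snd j)) \<omega>) =
    exp (- (\<integral>y. stationary_loss (b - a)
        (\<Prod>j\<in>S. if fst j \<and> y \<in> fst (snd j) then s j else 1)
        (\<Prod>j\<in>S. if \<not> fst j \<and> y \<in> fst (snd j) then s j else 1) * indicator (B n) y \<partial>\<Lambda>))"
proof -
  let ?W = "B n \<times> {0<..<real n}"
  note [measurable] = B_sets
  define u where "u y = (\<Prod>j\<in>S. if fst j \<and> y \<in> fst (snd j) then s j else 1)" for y
  define v where "v y = (\<Prod>j\<in>S. if \<not> fst j \<and> y \<in> fst (snd j) then s j else 1)" for y
  have [measurable]: "u \<in> borel_measurable X" "v \<in> borel_measurable X"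
    unfolding u_def v_def using S(1)[THEN ring_sets]
    by (auto intro!: borel_measurable_prod measurable_If_set simp: pred_def)
  have s01: "0 \<le> s j" "s j \<le> 1" for j using s[of j] by simp_all
  have u01: "0 \<le> u y \<and> u y \<le> 1" and v01: "0 \<le> v y \<and> v y \<le> 1" for y
    unfolding u_def v_def by (auto intro!: prod_nonneg prod_le_1 simp: s01)
  have uv_outside: "u y = 1" "v y = 1" if "y \<notin> B n" for y
  proof -
    have "y \<notin> fst (snd j)" if "j \<in> S" for j using S(2)[OF that] \<open>y \<notin> B n\<close> by blast
    then show "u y = 1" "v y = 1" unfolding u_def v_def by (simp_all cong: prod.cong)
  qed
  \<comment> \<open>Total factor of one point born at time \<open>r\<close> at location
    \<open>y\<close> with lifetime \<open>\<sigma>\<close>.\<close>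
  define w where "w r y \<sigma> = (if alive a r \<sigma> then u y else 1) * (if alive b r \<sigma> then v y else 1)" for r y \<sigma>
  have w01: "0 \<le> w r y \<sigma> \<and> w r y \<sigma> \<le> 1" for r y \<sigma>
    unfolding w_def using u01[of y] v01[of y] by (auto intro: mult_le_one)
  have w_prod: "(\<Prod>j\<in>S. if y \<in> fst (snd j) \<and> alive (if fst j then a else b) r \<sigma> then s j else 1) = w r y \<sigma>"
    for r y \<sigma>
  proof -
    have "(if alive a r \<sigma> then u y else 1) =
        (\<Prod>j\<in>S. if fst j \<and> y \<in> fst (snd j) \<and> alive a r \<sigma> then s j else 1)"
      by (simp add: u_def)
    moreover have "(if alive b r \<sigma> then v y else 1) =
        (\<Prod>j\<in>S. if \<not> fst j \<and> y \<in> fst (snd j) \<and> alive b r \<sigma> then s j else 1)"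
      by (simp add: v_def)
    ultimately show ?thesis
      unfolding w_def by (simp only: prod.distrib[symmetric]) (intro prod.cong, auto)
  qed
  have loss: "expectation (\<lambda>\<omega>. w r y (l i \<omega>)) = 1 - loss a b (u y) (v y) r"
    "expectation (\<lambda>\<omega>. w r y (l' i \<omega>)) = 1 - loss a b (u y) (v y) r" if "0 \<le> r" for r y i
    unfolding w_def using expectation_alive[OF _ ab(1,2) that] l_exponential l'_exponential by blast+
  define w1 where "w1 y = w 0 (fst y) (snd y)" for y :: "'a \<times> real"
  \<comment> \<open>The premises of \<open>marked_pgfl\<close> range over all pairs, also those with
    nonpositive time, while \<open>expectation_alive\<close> needs a nonnegative birth time. The
    guard sets the factor to 1 at nonpositive times, which lie outside the window.\<close>
  define w2 where "w2 y = (if 0 < snd (fst y) then w (snd (fst y)) (fst (fst y)) (snd y) else 1)"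
    for y :: "('a \<times> real) \<times> real"
  have w1_meas: "w1 \<in> borel_measurable (X \<Otimes>\<^sub>M borel)"
    unfolding w1_def w_def alive_def by measurable
  have w2_meas: "w2 \<in> borel_measurable ((X \<Otimes>\<^sub>M pos_time) \<Otimes>\<^sub>M borel)"
    unfolding w2_def w_def alive_def by measurable
  have w1_01: "0 \<le> w1 y \<and> w1 y \<le> 1" for y unfolding w1_def by (rule w01)
  have w2_01: "0 \<le> w2 y \<and> w2 y \<le> 1" for y unfolding w2_def using w01 by simp
  have w1_outside: "w1 (y, \<sigma>) = 1" if "y \<notin> B n" for y \<sigma>
    using that by (simp add: w1_def w_def uv_outside)
  have w2_outside: "w2 (y, \<sigma>) = 1" if "y \<notin> ?W" for y \<sigma>
    using that ab by (auto simp: w2_def w_def uv_outside alive_def mem_Times_iff)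
  define P1 where "P1 \<omega> = (\<Prod>i\<in>initials.points_in (B n) \<omega>. w1 (x i \<omega>, l i \<omega>))" for \<omega>
  define P2 where "P2 \<omega> = (\<Prod>j\<in>births.points_in ?W \<omega>. w2 (z j \<omega>, l' j \<omega>))" for \<omega>
  have "expectation (\<lambda>\<omega>. \<Prod>j\<in>S. s j ^ population (if fst j then a else b) (fst (snd j)) \<omega>) =
      expectation (\<lambda>\<omega>. P1 \<omega> * P2 \<omega>)"
  proof (rule Bochner_Integration.integral_cong[OF refl])
    fix \<omega> assume \<omega>: "\<omega> \<in> space M"
    have "(\<Prod>j\<in>S. s j ^ population (if fst j then a else b) (fst (snd j)) \<omega>) =
      (\<Prod>j\<in>S. (\<Prod>i\<in>initials.points_in (B n) \<omega>.
          if x i \<omega> \<in> fst (snd j) \<and> alive (if fst j then a else b) 0 (l i \<omega>) then s j else 1) *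
        (\<Prod>i\<in>births.points_in ?W \<omega>.
          if fst (z i \<omega>) \<in> fst (snd j) \<and> alive (if fst j then a else b) (snd (z i \<omega>)) (l' i \<omega>) then s j else 1))"
      using ab S(2) by (intro prod.cong refl power_population[OF \<omega>]) auto
    \<comment> \<open>Interchanging the product over \<open>S\<close> with the products over points
      collects all factors of each point.\<close>
    also have "\<dots> = (\<Prod>i\<in>initials.points_in (B n) \<omega>. w 0 (x i \<omega>) (l i \<omega>)) *
        (\<Prod>i\<in>births.points_in ?W \<omega>. w (snd (z i \<omega>)) (fst (z i \<omega>)) (l' i \<omega>))"
      unfolding w_prod[symmetric]
      by (simp only: prod.distrib prod.swap[of _ S])
    also have "\<dots> = P1 \<omega> * P2 \<omega>"
      unfolding P1_def P2_def w1_def w2_def using z_space[OF \<omega>] by simp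
    finally show "(\<Prod>j\<in>S. s j ^ population (if fst j then a else b) (fst (snd j)) \<omega>) = P1 \<omega> * P2 \<omega>" .
  qed
  also have "\<dots> = expectation P1 * expectation P2"
  proof (rule expectation_mult_disjoint_groups[OF sources_indep source_algebra_stable])
    show "insert Initial_Points (range Initial_Life) \<inter> insert Birth_Points (range Birth_Life) = {}" by auto
    show "P1 \<in> borel_measurable (sigma (space M)
        (\<Union> (source_algebra M X \<kappa> x l \<kappa>' z l' ` insert Initial_Points (range Initial_Life))))"
      unfolding P1_def initials.point_algebra_def[symmetric]
      by (rule initials.measurable_marked_prod[OF B_sets B_ring w1_meas w1_01 w1_outside])
    show "P2 \<in> borel_measurable (sigma (space M)
        (\<Union> (source_algebra M X \<kappa> x l \<kappa>' z l' ` insert Birth_Points (range Birth_Life))))"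
      unfolding P2_def births.point_algebra_def[symmetric]
      by (rule births.measurable_marked_prod[OF window_sets window_ring w2_meas w2_01 w2_outside])
    show "\<bar>P1 \<omega>\<bar> \<le> 1" "\<bar>P2 \<omega>\<bar> \<le> 1" for \<omega>
      unfolding P1_def P2_def by (intro abs_prod_le_1; simp add: abs_of_nonneg w1_01 w2_01)+
  qed
  also have "expectation P1 = exp (- (\<integral>y. (1 - (1 - loss a b (u y) (v y) 0)) * indicator (B n) y \<partial>\<Lambda>))"
    unfolding P1_def
  proof (rule initials.marked_pgfl[OF B_sets B_ring w1_meas w1_01 w1_outside B_finite])
    show "expectation (\<lambda>\<omega>. w1 (y, l i \<omega>)) = 1 - loss a b (u y) (v y) 0" for i y
      by (simp add: w1_def loss)
  qed
  also have "expectation P2 = exp (- (\<integral>y. (1 - (1 - (if 0 < snd y then loss a b (u (fst y)) (v (fst y)) (snd y) else 0)))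
      * indicator ?W y \<partial>(\<Lambda> \<Otimes>\<^sub>M pos_time)))"
    unfolding P2_def
  proof (rule births.marked_pgfl[OF window_sets window_ring w2_meas w2_01 w2_outside window_finite])
    show "expectation (\<lambda>\<omega>. w2 (y, l' i \<omega>)) =
        1 - (if 0 < snd y then loss a b (u (fst y)) (v (fst y)) (snd y) else 0)" for i y
      by (simp add: w2_def loss prob_space)
  qed
  \<comment> \<open>Birth times in the window are positive, so the guard of \<open>w2\<close>
    disappears.\<close>
  also have "(\<integral>y. (1 - (1 - (if 0 < snd y then loss a b (u (fst y)) (v (fst y)) (snd y) else 0)))
      * indicator ?W y \<partial>(\<Lambda> \<Otimes>\<^sub>M pos_time)) =
      (\<integral>y. loss a b (u (fst y)) (v (fst y)) (snd y) * indicator ?W y \<partial>(\<Lambda> \<Otimes>\<^sub>M pos_time))"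
    by (intro Bochner_Integration.integral_cong) (auto simp: indicator_def)
  also have "exp (- (\<integral>y. (1 - (1 - loss a b (u y) (v y) 0)) * indicator (B n) y \<partial>\<Lambda>)) *
      exp (- (\<integral>y. loss a b (u (fst y)) (v (fst y)) (snd y) * indicator ?W y \<partial>(\<Lambda> \<Otimes>\<^sub>M pos_time))) =
      exp (- (\<integral>y. stationary_loss (b - a) (u y) (v y) * indicator (B n) y \<partial>\<Lambda>))"
    using integral_loss_total[OF ab, of u v] u01 v01 by (simp add: exp_add[symmetric])
  finally show ?thesis unfolding u_def v_def .
qed

end

section \<open>Laws of pairs and their determination by counts\<close>

definition count_cylinder ::
  "'a measure \<Rightarrow> (nat \<Rightarrow> 'a set) \<Rightarrow> (bool \<times> 'a set \<times> nat) set \<Rightarrow> ('a measure \<times> 'a measure) set" where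
  "count_cylinder X B S = {p \<in> counting_measures X B \<times> counting_measures X B.
    \<forall>j\<in>S. emeasure (if fst j then fst p else snd p) (fst (snd j)) = of_nat (snd (snd j))}"

definition count_cylinders :: "'a measure \<Rightarrow> (nat \<Rightarrow> 'a set) \<Rightarrow> ('a measure \<times> 'a measure) set set" where
  "count_cylinders X B =
    {count_cylinder X B S | S. finite S \<and> (\<forall>j\<in>S. fst (snd j) \<in> localizing_ring X B)}"

text \<open>Generated directly by the cylinders, an intersection-stable family on which the laws of
  two pairs can be compared. That both components are measurable is recovered in
  \<open>measurable_pair_space_component\<close>.\<close>

definition pair_space :: "'a measure \<Rightarrow> (nat \<Rightarrow> 'a set) \<Rightarrow> ('a measure \<times> 'a measure) measure" where
  "pair_space X B = sigma (counting_measures X B \<times> counting_measures X B) (count_cylinders X B)"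

lemma count_cylinders_Pow: "count_cylinders X B \<subseteq> Pow (counting_measures X B \<times> counting_measures X B)"
  unfolding count_cylinders_def count_cylinder_def by auto

lemma space_pair_space: "space (pair_space X B) = counting_measures X B \<times> counting_measures X B"
  unfolding pair_space_def using count_cylinders_Pow by (rule space_measure_of)

lemma sets_pair_space:
  "sets (pair_space X B) = sigma_sets (counting_measures X B \<times> counting_measures X B) (count_cylinders X B)"
  unfolding pair_space_def using count_cylinders_Pow by (rule sets_measure_of)

text \<open>A cylinder is encoded by a finite set of conditions, so intersecting cylinders means
  uniting condition sets.\<close>

lemma Int_stable_count_cylinders: "Int_stable (count_cylinders X B)"
proof (rule Int_stableI)
  fix C D assume "C \<in> count_cylinders X B" "D \<in> count_cylinders X B"
  then obtain S T where "finite S" "\<forall>j\<in>S. fst (snd j) \<in> localizing_ring X B" "C = count_cylinder X B S"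
    and "finite T" "\<forall>j\<in>T. fst (snd j) \<in> localizing_ring X B" "D = count_cylinder X B T"
    unfolding count_cylinders_def by auto
  moreover have "count_cylinder X B S \<inter> count_cylinder X B T = count_cylinder X B (S \<union> T)"
    unfolding count_cylinder_def by auto
  ultimately show "C \<inter> D \<in> count_cylinders X B"
    unfolding count_cylinders_def by (auto intro!: exI[of _ "S \<union> T"])
qed

lemma measurable_counting_measure_space:
  assumes "\<And>p. p \<in> space N \<Longrightarrow> g p \<in> counting_measures X B"
    and "\<And>A. A \<in> sets X \<Longrightarrow> (\<lambda>p. emeasure (g p) A) \<in> borel_measurable N"
  shows "g \<in> measurable N (counting_measure_space X B)"
  unfolding counting_measure_space_def
proof (rule measurable_measure_of)
  fix Y assume "Y \<in> {(\<lambda>\<mu>. emeasure \<mu> A) -` C \<inter> counting_measures X B | A C.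
         A \<in> sets X \<and> C \<in> sets (borel :: ennreal measure)}"
  then obtain A C where Y: "Y = (\<lambda>\<mu>. emeasure \<mu> A) -` C \<inter> counting_measures X B"
    and AC: "A \<in> sets X" "C \<in> sets (borel :: ennreal measure)" by auto
  have "g -` Y \<inter> space N = (\<lambda>p. emeasure (g p) A) -` C \<inter> space N"
    unfolding Y using assms(1) by auto
  then show "g -` Y \<inter> space N \<in> sets N"
    using measurable_sets[OF assms(2)[OF AC(1)] AC(2)] by simp
qed (use assms(1) in auto)

lemma borel_measurable_of_nat_valued:
  fixes g :: "'b \<Rightarrow> ennreal"
  assumes "\<And>p. p \<in> space N \<Longrightarrow> \<exists>k::nat. g p = of_nat k"
    and "\<And>k::nat. {p \<in> space N. g p = of_nat k} \<in> sets N"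
  shows "g \<in> borel_measurable N"
proof -
  obtain k :: "'b \<Rightarrow> nat" where k: "\<And>p. p \<in> space N \<Longrightarrow> g p = of_nat (k p)" using assms(1) by metis
  have "k \<in> measurable N (count_space UNIV)"
  proof (subst measurable_count_space_eq_countable, simp, intro conjI ballI)
    fix m
    have "k -` {m} \<inter> space N = {p \<in> space N. g p = of_nat m}" using k by auto
    then show "k -` {m} \<inter> space N \<in> sets N" using assms(2) by simp
  qed simp
  then have "(\<lambda>p. of_nat (k p) :: ennreal) \<in> borel_measurable N" by measurable
  then show ?thesis using k by (simp cong: measurable_cong)
qed

context birth_death
begin

lemma measurable_pair_space_component:
  "(\<lambda>p. if c then fst p else snd p) \<in> measurable (pair_space X B) (counting_measure_space X B)"
proof (rule measurable_counting_measure_space)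
  let ?g = "\<lambda>p. if c then fst p else snd p"
  show space: "?g p \<in> counting_measures X B" if "p \<in> space (pair_space X B)" for p
    using that by (auto simp: space_pair_space)
  have ring: "(\<lambda>p. emeasure (?g p) A) \<in> borel_measurable (pair_space X B)"
    if A: "A \<in> localizing_ring X B" for A
  proof (rule borel_measurable_of_nat_valued)
    show "\<exists>k::nat. emeasure (?g p) A = of_nat k" if "p \<in> space (pair_space X B)" for p
      using space[OF that] A by (auto elim: counting_measuresD)
    fix k :: nat
    have "{p \<in> space (pair_space X B). emeasure (?g p) A = of_nat k} = count_cylinder X B {(c, A, k)}"
      by (auto simp: space_pair_space count_cylinder_def)
    also have "\<dots> \<in> count_cylinders X B"
      unfolding count_cylinders_def using A by (intro CollectI exI[of _ "{(c, A, k)}"]) auto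
    finally show "{p \<in> space (pair_space X B). emeasure (?g p) A = of_nat k} \<in> sets (pair_space X B)"
      unfolding sets_pair_space by (rule sigma_sets.Basic)
  qed
  fix A assume A: "A \<in> sets X"
  \<comment> \<open>Cylinders control only sets of the localizing ring; a general \<open>A\<close>
    is reached through the increasing sets \<open>A \<inter> B n\<close>.\<close>
  have "emeasure (?g p) A = (SUP n. emeasure (?g p) (A \<inter> B n))" if "p \<in> space (pair_space X B)" for p
  proof -
    have sets: "sets (?g p) = sets X" using space[OF that] unfolding counting_measures_def by auto
    have "range (\<lambda>n. A \<inter> B n) \<subseteq> sets (?g p)" using A B_sets by (auto simp: sets)
    moreover have "incseq (\<lambda>n. A \<inter> B n)"
      using localizing by (auto simp: localizing_sequence_def incseq_def)
    ultimately have "(SUP n. emeasure (?g p) (A \<inter> B n)) = emeasure (?g p) (\<Union>n. A \<inter> B n)"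
      by (rule SUP_emeasure_incseq)
    also have "(\<Union>n. A \<inter> B n) = A"
      using localizing sets.sets_into_space[OF A] by (auto simp: localizing_sequence_def)
    finally show ?thesis by simp
  qed
  moreover have "A \<inter> B n \<in> localizing_ring X B" for n
    using A unfolding localizing_ring_def by auto
  then have "(\<lambda>p. SUP n. emeasure (?g p) (A \<inter> B n)) \<in> borel_measurable (pair_space X B)"
    by (intro borel_measurable_SUP ring) auto
  ultimately show "(\<lambda>p. emeasure (?g p) A) \<in> borel_measurable (pair_space X B)"
    by (simp cong: measurable_cong)
qed

lemma vimage_count_cylinder:
  assumes "0 \<le> a" "0 \<le> b" "\<And>j. j \<in> S \<Longrightarrow> fst (snd j) \<in> localizing_ring X B"
  shows "(\<lambda>\<omega>. (\<eta>t a \<omega>, \<eta>t b \<omega>)) -` count_cylinder X B S \<inter> space M =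
    {\<omega> \<in> space M. \<forall>j\<in>S. population (if fst j then a else b) (fst (snd j)) \<omega> = snd (snd j)}"
proof -
  have "emeasure (if c then \<eta>t a \<omega> else \<eta>t b \<omega>) A = of_nat m \<longleftrightarrow> population (if c then a else b) A \<omega> = m"
    if "\<omega> \<in> space M" "A \<in> localizing_ring X B" for \<omega> A m c
    using emeasure_\<eta>t_population[OF _ that] assms(1,2) by simp
  then have "(\<forall>j\<in>S. emeasure (if fst j then \<eta>t a \<omega> else \<eta>t b \<omega>) (fst (snd j)) = of_nat (snd (snd j))) \<longleftrightarrow>
      (\<forall>j\<in>S. population (if fst j then a else b) (fst (snd j)) \<omega> = snd (snd j))" if "\<omega> \<in> space M" for \<omega>
    using that assms(3) by (intro ball_cong refl) blast
  then show ?thesis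
    using \<eta>t_counting_measures assms(1,2)
    by (intro set_eqI) (simp add: count_cylinder_def conj_commute cong: conj_cong if_cong split del: if_split)
qed

lemma measurable_\<eta>t_pair:
  assumes "0 \<le> a" "0 \<le> b"
  shows "(\<lambda>\<omega>. (\<eta>t a \<omega>, \<eta>t b \<omega>)) \<in> measurable M (pair_space X B)"
  unfolding pair_space_def
proof (rule measurable_measure_of[OF count_cylinders_Pow])
  fix Y assume "Y \<in> count_cylinders X B"
  then obtain S where S: "finite S" "\<And>j. j \<in> S \<Longrightarrow> fst (snd j) \<in> localizing_ring X B"
    and Y: "Y = count_cylinder X B S" unfolding count_cylinders_def by auto
  have "population (if fst j then a else b) (fst (snd j)) \<in> measurable M (count_space UNIV)" if "j \<in> S" for j
    using assms S(2)[OF that] by (simp add: measurable_population)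
  then have "{\<omega> \<in> space M. \<forall>j\<in>S. population (if fst j then a else b) (fst (snd j)) \<omega> = snd (snd j)} \<in> events"
    using S(1) by (intro sets.sets_Collect_finite_All) (auto intro: measurable_sets_Collect)
  then show "(\<lambda>\<omega>. (\<eta>t a \<omega>, \<eta>t b \<omega>)) -` Y \<inter> space M \<in> events"
    unfolding Y by (subst vimage_count_cylinder[OF assms S(2)]) auto
qed (use assms \<eta>t_counting_measures in auto)

text \<open>The generating functions of the counts at the times (a, b) and (0, b - a) coincide
  because \<open>stationary_loss\<close> sees only the lag. Uniqueness gives equal cylinder
  probabilities, hence equal laws.\<close>

lemma distr_\<eta>t_pair:
  assumes ab: "0 \<le> a" "a \<le> b"
  shows "distr M (pair_space X B) (\<lambda>\<omega>. (\<eta>t a \<omega>, \<eta>t b \<omega>)) =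
    distr M (pair_space X B) (\<lambda>\<omega>. (\<eta>t 0 \<omega>, \<eta>t (b - a) \<omega>))"
proof (rule measure_eqI_generator_eq[OF Int_stable_count_cylinders count_cylinders_Pow])
  let ?\<Omega> = "counting_measures X B \<times> counting_measures X B"
  \<comment> \<open>The empty set of conditions gives the whole space, which serves as a constant
    exhausting sequence.\<close>
  have "?\<Omega> = count_cylinder X B {}" by (simp add: count_cylinder_def)
  then have "?\<Omega> \<in> count_cylinders X B"
    unfolding count_cylinders_def by (intro CollectI exI[of _ "{}"]) simp
  then show "range (\<lambda>_::nat. ?\<Omega>) \<subseteq> count_cylinders X B" by auto
  interpret D: prob_space "distr M (pair_space X B) (\<lambda>\<omega>. (\<eta>t a \<omega>, \<eta>t b \<omega>))"
    using ab by (intro prob_space_distr measurable_\<eta>t_pair) auto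
  show "emeasure (distr M (pair_space X B) (\<lambda>\<omega>. (\<eta>t a \<omega>, \<eta>t b \<omega>))) ?\<Omega> \<noteq> \<infinity>" by simp
  fix Y assume Y_cyl: "Y \<in> count_cylinders X B"
  then obtain S where S: "finite S" "\<And>j. j \<in> S \<Longrightarrow> fst (snd j) \<in> localizing_ring X B"
    and Y: "Y = count_cylinder X B S" unfolding count_cylinders_def by auto
  \<comment> \<open>One window serves both pairs of times, since b - a \<le> b < n.\<close>
  obtain n where n: "\<And>A. A \<in> (\<lambda>j. fst (snd j)) ` S \<Longrightarrow> A \<subseteq> B n" "b < real n"
    by (rule window_exists[of "(\<lambda>j. fst (snd j)) ` S" b]) (use S in auto)
  have emeasure: "emeasure (distr M (pair_space X B) (\<lambda>\<omega>. (\<eta>t c \<omega>, \<eta>t d \<omega>))) Y =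
      prob {\<omega> \<in> space M. \<forall>j\<in>S. population (if fst j then c else d) (fst (snd j)) \<omega> = snd (snd j)}"
    if "0 \<le> c" "0 \<le> d" for c d
    using that S(2) Y_cyl unfolding Y
    by (subst emeasure_distr) (auto simp: measurable_\<eta>t_pair vimage_count_cylinder sets_pair_space emeasure_eq_measure)
  have "prob {\<omega> \<in> space M. \<forall>j\<in>S. population (if fst j then a else b) (fst (snd j)) \<omega> = snd (snd j)} =
      prob {\<omega> \<in> space M. \<forall>j\<in>S. population (if fst j then 0 else b - a) (fst (snd j)) \<omega> = snd (snd j)}"
  proof (rule pgf_eq_imp_prob_eq[OF _ _ S(1)])
    fix s :: "bool \<times> 'a set \<times> nat \<Rightarrow> real" assume s: "\<And>j. 0 < s j \<and> s j < 1"
    show "expectation (\<lambda>\<omega>. \<Prod>j\<in>S. s j ^ population (if fst j then a else b) (fst (snd j)) \<omega>) =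
      expectation (\<lambda>\<omega>. \<Prod>j\<in>S. s j ^ population (if fst j then 0 else b - a) (fst (snd j)) \<omega>)"
      using pgf_population[OF ab n(2) S(1) S(2) n(1) s] pgf_population[of 0 "b - a" n S s, OF _ _ _ S(1) S(2) n(1) s]
        ab n(2) by simp
  qed (use ab S(2) in \<open>auto intro!: measurable_population\<close>)
  then show "emeasure (distr M (pair_space X B) (\<lambda>\<omega>. (\<eta>t a \<omega>, \<eta>t b \<omega>))) Y =
      emeasure (distr M (pair_space X B) (\<lambda>\<omega>. (\<eta>t 0 \<omega>, \<eta>t (b - a) \<omega>))) Y"
    using ab by (simp add: emeasure)
qed (simp_all add: sets_pair_space)

lemma expectation_\<eta>t_pair:
  fixes g :: "'a measure \<times> 'a measure \<Rightarrow> real"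
  assumes "0 \<le> a" "a \<le> b" and g: "g \<in> borel_measurable (pair_space X B)"
  shows "expectation (\<lambda>\<omega>. g (\<eta>t a \<omega>, \<eta>t b \<omega>)) = expectation (\<lambda>\<omega>. g (\<eta> \<omega>, \<eta>t (b - a) \<omega>))"
proof -
  have "expectation (\<lambda>\<omega>. g (\<eta>t a \<omega>, \<eta>t b \<omega>)) = expectation (\<lambda>\<omega>. g (\<eta>t 0 \<omega>, \<eta>t (b - a) \<omega>))"
    using integral_distr[OF measurable_\<eta>t_pair g, of a b] integral_distr[OF measurable_\<eta>t_pair g, of 0 "b - a"]
      distr_\<eta>t_pair[OF assms(1,2)] assms(1,2) by simp
  also have "\<dots> = expectation (\<lambda>\<omega>. g (\<eta> \<omega>, \<eta>t (b - a) \<omega>))"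
    by (intro Bochner_Integration.integral_cong) (auto simp: \<eta>t_0)
  finally show ?thesis .
qed

lemma measurable_\<eta>t:
  assumes "0 \<le> t" shows "\<eta>t t \<in> measurable M (counting_measure_space X B)"
  using \<eta>t_counting_measures[OF assms] measurable_emeasure_\<eta>t[OF assms]
  by (rule measurable_counting_measure_space)

text \<open>Equality of the means is pair stationarity with both times equal. It allows one centring
  constant for all times, so that a covariance is the expectation of a single function of the
  pair.\<close>

lemma
  assumes f: "f \<in> borel_measurable (counting_measure_space X B)" and st: "0 \<le> s" "s \<le> t"
  shows expectation_stationary: "expectation (\<lambda>\<omega>. f (\<eta>t s \<omega>)) = (expectation (\<lambda>\<omega>. f (\<eta> \<omega>)) :: real)"
    and covariance_stationary: "covariance M (\<lambda>\<omega>. f (\<eta>t s \<omega>)) (\<lambda>\<omega>. f (\<eta>t t \<omega>)) =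
      covariance M (\<lambda>\<omega>. f (\<eta> \<omega>)) (\<lambda>\<omega>. f (\<eta>t (t - s) \<omega>))"
proof -
  have comp: "(\<lambda>p. f (fst p)) \<in> borel_measurable (pair_space X B)"
    "(\<lambda>p. f (snd p)) \<in> borel_measurable (pair_space X B)"
    using measurable_compose[OF measurable_pair_space_component[of True] f]
      measurable_compose[OF measurable_pair_space_component[of False] f] by simp_all
  have mean: "expectation (\<lambda>\<omega>. f (\<eta>t s \<omega>)) = expectation (\<lambda>\<omega>. f (\<eta> \<omega>))" if "0 \<le> s" for s
    using expectation_\<eta>t_pair[OF that order_refl comp(1)] by simp
  then show "expectation (\<lambda>\<omega>. f (\<eta>t s \<omega>)) = expectation (\<lambda>\<omega>. f (\<eta> \<omega>))" using st by simp
  define m where "m = expectation (\<lambda>\<omega>. f (\<eta> \<omega>))"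
  have "(\<lambda>p. (f (fst p) - m) * (f (snd p) - m)) \<in> borel_measurable (pair_space X B)"
    using comp by measurable
  from expectation_\<eta>t_pair[OF st this]
  show "covariance M (\<lambda>\<omega>. f (\<eta>t s \<omega>)) (\<lambda>\<omega>. f (\<eta>t t \<omega>)) =
      covariance M (\<lambda>\<omega>. f (\<eta> \<omega>)) (\<lambda>\<omega>. f (\<eta>t (t - s) \<omega>))"
    using st by (simp add: covariance_def mean m_def)
qed

end

subsection \<open>Paths without exceptional times\<close>

lemma piecewise_constant_one_sided:
  assumes g: "piecewise_constant g"
  shows "0 \<le> t \<Longrightarrow> \<forall>\<^sub>F s in at_right t. g s = g t"
    and "0 < t \<Longrightarrow> \<exists>c. \<forall>\<^sub>F s in at_left t. g s = c"
proof -
  \<comment> \<open>The extra unit beyond \<open>t\<close> leaves room for a right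
    neighbourhood.\<close>
  have repr: "\<exists>(n::nat) (a :: nat \<Rightarrow> real) b c. \<forall>s \<in> {0..t + 1}. g s = (\<Sum>i<n. c i * indicator {a i..<b i} s)"
    if "0 \<le> t" for t
    using g that unfolding piecewise_constant_def by auto
  {
    assume "0 \<le> t"
    from repr[OF this] obtain n :: nat and a b c :: "nat \<Rightarrow> real"
      where eq: "\<And>s. s \<in> {0..t + 1} \<Longrightarrow> g s = (\<Sum>i<n. c i * indicator {a i..<b i} s)" by auto
    have "\<forall>\<^sub>F s in at_right t. indicator {a i..<b i} s = (indicator {a i..<b i} t :: real)" for i
    proof -
      have "\<forall>\<^sub>F s in at_right t. (t < a i \<longrightarrow> s < a i) \<and> (t < b i \<longrightarrow> s < b i)"
        by (intro eventually_conj; cases "t < a i"; cases "t < b i")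
          (auto simp: eventually_at_right_field)
      then show ?thesis using eventually_at_right_less[of t]
        by eventually_elim (auto simp: indicator_def)
    qed
    then have "\<forall>\<^sub>F s in at_right t. \<forall>i\<in>{..<n}. indicator {a i..<b i} s = (indicator {a i..<b i} t :: real)"
      by (intro eventually_ball_finite) auto
    moreover have "\<forall>\<^sub>F s in at_right t. t < s \<and> s < t + 1"
      unfolding eventually_at_right_field by (intro exI[of _ "t + 1"]) auto
    ultimately show "\<forall>\<^sub>F s in at_right t. g s = g t"
    proof eventually_elim
      case (elim s)
      have "g s = (\<Sum>i<n. c i * indicator {a i..<b i} s)" using elim \<open>0 \<le> t\<close> by (intro eq) auto
      also have "\<dots> = (\<Sum>i<n. c i * indicator {a i..<b i} t)" using elim by (intro sum.cong) auto
      also have "\<dots> = g t" using \<open>0 \<le> t\<close> by (intro eq[symmetric]) auto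
      finally show ?case .
    qed
  next
    assume "0 < t"
    then obtain n :: nat and a b c :: "nat \<Rightarrow> real"
      where eq: "\<And>s. s \<in> {0..t + 1} \<Longrightarrow> g s = (\<Sum>i<n. c i * indicator {a i..<b i} s)"
      using repr[of t] by auto
    \<comment> \<open>Just to the left of \<open>t\<close>, the indicator of [a,b) is 1 exactly when
      a < t \<le> b, whereas at \<open>t\<close> itself the condition is a \<le> t < b.\<close>
    have "\<forall>\<^sub>F s in at_left t. indicator {a i..<b i} s = (of_bool (a i < t \<and> t \<le> b i) :: real)" for i
    proof -
      have "\<forall>\<^sub>F s in at_left t. (a i < t \<longrightarrow> a i < s) \<and> (b i < t \<longrightarrow> b i < s)"
        by (intro eventually_conj; cases "a i < t"; cases "b i < t")
          (auto simp: eventually_at_left_field)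
      moreover have "\<forall>\<^sub>F s in at_left t. s < t"
        unfolding eventually_at_left_field by (intro exI[of _ "t - 1"]) auto
      ultimately show ?thesis by eventually_elim (auto simp: indicator_def)
    qed
    then have "\<forall>\<^sub>F s in at_left t. \<forall>i\<in>{..<n}. indicator {a i..<b i} s = (of_bool (a i < t \<and> t \<le> b i) :: real)"
      by (intro eventually_ball_finite) auto
    moreover have "\<forall>\<^sub>F s in at_left t. 0 < s \<and> s < t"
      unfolding eventually_at_left_field using \<open>0 < t\<close> by (intro exI[of _ 0]) auto
    ultimately have "\<forall>\<^sub>F s in at_left t. g s = (\<Sum>i<n. c i * of_bool (a i < t \<and> t \<le> b i))"
    proof eventually_elim
      case (elim s)
      have "g s = (\<Sum>i<n. c i * indicator {a i..<b i} s)" using elim by (intro eq) auto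
      also have "\<dots> = (\<Sum>i<n. c i * of_bool (a i < t \<and> t \<le> b i))" using elim by (intro sum.cong) auto
      finally show ?case .
    qed
    then show "\<exists>c. \<forall>\<^sub>F s in at_left t. g s = c" by blast
  }
qed

text \<open>Without exceptional times in (u,v] the path would be left-continuous there, and
  piecewise constancy already makes it right-continuous. A continuous path between 0 and 1 would
  take the value 1/2.\<close>

lemma exceptional_time_between:
  assumes g: "piecewise_constant (\<lambda>t. f (\<mu> t))" and "\<And>t. 0 \<le> t \<Longrightarrow> f (\<mu> t) \<in> {0, 1}"
    and uv: "0 \<le> u" "u \<le> v" and "f (\<mu> u) \<noteq> f (\<mu> v)"
  shows "\<exists>t \<in> exceptional_times f \<mu>. u < t \<and> t \<le> v"
proof (rule ccontr)
  assume none: "\<not> ?thesis"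
  let ?g = "\<lambda>t. f (\<mu> t)"
  have "u < v" using uv assms(5) by (cases "u = v") auto
  have right: "(?g \<longlongrightarrow> ?g t) (at_right t)" if "0 \<le> t" for t
    by (rule tendsto_eventually) (rule piecewise_constant_one_sided(1)[OF g that])
  have left: "(?g \<longlongrightarrow> ?g t) (at_left t)" if t: "u < t" "t \<le> v" for t
  proof -
    obtain c where "\<forall>\<^sub>F s in at_left t. ?g s = c"
      using piecewise_constant_one_sided(2)[OF g, of t] t uv by auto
    then have lim: "(?g \<longlongrightarrow> c) (at_left t)" by (rule tendsto_eventually)
    \<comment> \<open>\<open>exceptional_times\<close> is defined through \<open>Lim\<close>, whose
      value is determined only once a left limit is known to exist.\<close>
    then have "Lim (at_left t) ?g = c" by (intro tendsto_Lim) simp_all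
    moreover have "?g t = Lim (at_left t) ?g"
      using none t uv unfolding exceptional_times_def by auto
    ultimately show ?thesis using lim by simp
  qed
  have cont: "continuous_on {u..v} ?g"
    unfolding continuous_on_def
  proof
    fix t assume t: "t \<in> {u..v}"
    show "(?g \<longlongrightarrow> ?g t) (at t within {u..v})"
    proof (cases "t = u")
      case True
      then show ?thesis
        using right[of u] uv \<open>u < v\<close> by (simp add: at_within_Icc_at_right)
    next
      case False
      then have "(?g \<longlongrightarrow> ?g t) (at t)"
        using left[of t] right[of t] t uv by (auto intro: filterlim_split_at)
      then show ?thesis by (rule tendsto_within_subset) simp
    qed
  qed
  have "?g u \<in> {0, 1}" "?g v \<in> {0, 1}" using assms(2) uv by auto
  with assms(5) consider "?g u = 0" "?g v = 1" | "?g u = 1" "?g v = 0" by auto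
  then obtain t where "t \<in> {u..v}" "?g t = 1/2"
  proof cases
    case 1
    then show ?thesis using IVT'[of ?g u "1/2" v] uv cont that by auto
  next
    case 2
    then show ?thesis using IVT2'[of ?g v "1/2" u] uv cont that by auto
  qed
  then show False using assms(2)[of t] uv by auto
qed

text \<open>Block \<open>i\<close> has the sample indices \<open>i * k\<close> to
  \<open>i * k + (k - 1)\<close>. A nonconstant block contains an exceptional time strictly after
  its first sample and not after its last one, hence not after the first sample of the next block.
  So different blocks yield different times.\<close>

lemma exceptional_times_ge_nonconstant_blocks:
  assumes g: "piecewise_constant (\<lambda>t. f (\<mu> t))" and f01: "\<And>t. 0 \<le> t \<Longrightarrow> f (\<mu> t) \<in> {0, 1}"
    and c: "0 \<le> c" and L: "0 < L" and k: "0 < k"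
    and nonconst: "\<And>i. i < L \<Longrightarrow> \<exists>j<k. f (\<mu> (c * real (i * k + j) / real (L * k))) \<noteq> f (\<mu> (c * real (i * k) / real (L * k)))"
  shows "of_nat L \<le> cardinality (exceptional_times f \<mu> \<inter> {0..c})"
proof -
  define \<tau> where "\<tau> q = c * real q / real (L * k)" for q
  have \<tau>_mono: "\<tau> q \<le> \<tau> q'" if "q \<le> q'" for q q'
    unfolding \<tau>_def using that c by (intro divide_right_mono mult_left_mono) auto
  have \<tau>_0: "0 \<le> \<tau> q" for q using c by (simp add: \<tau>_def)
  have \<tau>_c: "\<tau> (L * k) = c" using L k by (simp add: \<tau>_def)
  have "\<exists>t. t \<in> exceptional_times f \<mu> \<and> \<tau> (i * k) < t \<and> t \<le> \<tau> (i * k + (k - 1))" if i: "i < L" for i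
  proof -
    obtain j where j: "j < k" "f (\<mu> (\<tau> (i * k + j))) \<noteq> f (\<mu> (\<tau> (i * k)))"
      using nonconst[OF i] by (auto simp: \<tau>_def)
    have "\<exists>t \<in> exceptional_times f \<mu>. \<tau> (i * k) < t \<and> t \<le> \<tau> (i * k + j)"
      using j(2) by (intro exceptional_time_between[OF g f01] \<tau>_0 \<tau>_mono) auto
    moreover have "\<tau> (i * k + j) \<le> \<tau> (i * k + (k - 1))" using j(1) by (intro \<tau>_mono) simp
    ultimately show ?thesis by (meson order_trans)
  qed
  then obtain T where T: "\<And>i. i < L \<Longrightarrow> T i \<in> exceptional_times f \<mu>"
    "\<And>i. i < L \<Longrightarrow> \<tau> (i * k) < T i" "\<And>i. i < L \<Longrightarrow> T i \<le> \<tau> (i * k + (k - 1))" by metis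
  have T_less: "T i < T i'" if "i < i'" "i' < L" for i i'
  proof -
    have "Suc i * k \<le> i' * k" using that by (intro mult_right_mono) auto
    then have "i * k + (k - 1) \<le> i' * k" by simp
    then show ?thesis using T(2)[of i'] T(3)[of i] that \<tau>_mono by fastforce
  qed
  then have inj: "inj_on T {..<L}" by (intro linorder_inj_onI) (auto simp: less_imp_neq)
  have "T i \<in> {0..c}" if "i < L" for i
  proof -
    have "Suc i * k \<le> L * k" using that by (intro mult_right_mono) auto
    then have "\<tau> (i * k + (k - 1)) \<le> c" unfolding \<tau>_c[symmetric] by (intro \<tau>_mono) simp
    then show ?thesis using T(2,3)[OF that] \<tau>_0[of "i * k"] by auto
  qed
  then have "T ` {..<L} \<subseteq> exceptional_times f \<mu> \<inter> {0..c}" using T(1) by auto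
  then have "cardinality (T ` {..<L}) \<le> cardinality (exceptional_times f \<mu> \<inter> {0..c})"
    by (intro emeasure_mono) auto
  then show ?thesis using inj by (simp add: emeasure_count_space card_image)
qed

subsection \<open>Block averages\<close>

text \<open>Chebyshev's inequality. In the variance of the average, the k diagonal terms are at most
  1 and account for 1/k; the remaining terms are covered by \<delta>.\<close>

lemma (in prob_space) average_deviation:
  fixes Y :: "nat \<Rightarrow> 'a \<Rightarrow> real"
  assumes Y[measurable]: "\<And>j. j < k \<Longrightarrow> Y j \<in> borel_measurable M"
    and Y01: "\<And>j \<omega>. j < k \<Longrightarrow> \<omega> \<in> space M \<Longrightarrow> Y j \<omega> \<in> {0, 1}"
    and mean: "\<And>j. j < k \<Longrightarrow> expectation (Y j) = p"
    and cov: "\<And>i j. i < j \<Longrightarrow> j < k \<Longrightarrow> covariance M (Y i) (Y j) \<le> \<delta>"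
    and k: "0 < k" and \<gamma>: "0 < \<gamma>" and \<delta>: "0 \<le> \<delta>"
  shows "prob {\<omega> \<in> space M. \<gamma> \<le> \<bar>(\<Sum>j<k. Y j \<omega>) / real k - p\<bar>} \<le> (1 / real k + \<delta>) / \<gamma>\<^sup>2"
proof -
  have Y_bounds: "0 \<le> Y j \<omega>" "Y j \<omega> \<le> 1" if "j < k" "\<omega> \<in> space M" for j \<omega>
    using Y01[OF that] by auto
  have int: "integrable M (Y j)" if "j < k" for j
    using Y_bounds[OF that] by (intro integrable_const_bound[where B=1] AE_I2 Y[OF that]) (simp add: abs_le_iff)
  have p: "0 \<le> p" "p \<le> 1"
  proof -
    have "0 \<le> expectation (Y 0)" using Y_bounds[OF k] by (intro integral_nonneg_AE AE_I2)
    moreover have "expectation (Y 0) \<le> expectation (\<lambda>_. 1)"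
      using Y_bounds[OF k] by (intro integral_mono_AE int[OF k] AE_I2) auto
    ultimately show "0 \<le> p" "p \<le> 1" using mean[OF k] by (simp_all add: prob_space)
  qed
  define Z where "Z j \<omega> = Y j \<omega> - p" for j \<omega>
  have Z_meas: "Z j \<in> borel_measurable M" if "j < k" for j
    using Y[OF that] unfolding Z_def by measurable
  have Z1: "\<bar>Z j \<omega>\<bar> \<le> 1" if "j < k" "\<omega> \<in> space M" for j \<omega>
    using Y_bounds[OF that] p by (auto simp: Z_def)
  have Z_int: "integrable M (\<lambda>\<omega>. Z i \<omega> * Z j \<omega>)" if "i < k" "j < k" for i j
    using Z1 that by (intro integrable_const_bound[where B=1] AE_I2 borel_measurable_times Z_meas)
      (auto simp: abs_mult intro!: mult_le_one)
  \<comment> \<open>Adding \<open>\<delta>\<close> on the diagonal as well makes the double sum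
    exactly k + k^2 \<delta>.\<close>
  have Z_le: "expectation (\<lambda>\<omega>. Z i \<omega> * Z j \<omega>) \<le> (if i = j then 1 else 0) + \<delta>" if "i < k" "j < k" for i j
  proof -
    have "expectation (\<lambda>\<omega>. Z i \<omega> * Z j \<omega>) \<le> \<delta>" if "i < j" "j < k" for i j
      using cov[OF that] mean that by (simp add: covariance_def Z_def)
    from this[of i j] this[of j i] that
    have "expectation (\<lambda>\<omega>. Z i \<omega> * Z j \<omega>) \<le> \<delta>" if "i \<noteq> j"
      using that by (cases "i < j") (auto simp: mult.commute)
    moreover have "expectation (\<lambda>\<omega>. Z i \<omega> * Z i \<omega>) \<le> expectation (\<lambda>_. 1)"
    proof (intro integral_mono Z_int that)
      show "Z i \<omega> * Z i \<omega> \<le> 1" if "\<omega> \<in> space M" for \<omega>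
        using Z1[OF \<open>i < k\<close> that] by (simp add: abs_square_le_1 flip: power2_eq_square)
    qed simp
    ultimately show ?thesis using \<delta> by (auto simp: prob_space)
  qed
  define V where "V \<omega> = (\<Sum>j<k. Y j \<omega>) / real k" for \<omega>
  have V_meas: "V \<in> borel_measurable M" unfolding V_def using Y by (intro borel_measurable_divide borel_measurable_sum) auto
  have V_p: "V \<omega> - p = (\<Sum>j<k. Z j \<omega>) / real k" for \<omega>
    using k by (simp add: V_def Z_def sum_subtractf field_simps)
  have "expectation V = p"
    using k int mean by (simp add: V_def[abs_def])
  have "variance V = expectation (\<lambda>\<omega>. (\<Sum>i<k. \<Sum>j<k. Z i \<omega> * Z j \<omega>) / (real k)\<^sup>2)"
    unfolding \<open>expectation V = p\<close> V_p by (simp add: power_divide power2_eq_square sum_product)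
  also have "\<dots> = (\<Sum>i<k. \<Sum>j<k. expectation (\<lambda>\<omega>. Z i \<omega> * Z j \<omega>)) / (real k)\<^sup>2"
  proof -
    have "expectation (\<lambda>\<omega>. \<Sum>i<k. \<Sum>j<k. Z i \<omega> * Z j \<omega>) = (\<Sum>i<k. expectation (\<lambda>\<omega>. \<Sum>j<k. Z i \<omega> * Z j \<omega>))"
      by (intro Bochner_Integration.integral_sum Bochner_Integration.integrable_sum Z_int) auto
    also have "\<dots> = (\<Sum>i<k. \<Sum>j<k. expectation (\<lambda>\<omega>. Z i \<omega> * Z j \<omega>))"
      by (intro sum.cong refl Bochner_Integration.integral_sum Z_int) auto
    finally show ?thesis by simp
  qed
  also have "\<dots> \<le> (\<Sum>i<k. \<Sum>j<k. (if i = j then 1 else 0) + \<delta>) / (real k)\<^sup>2"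
    by (intro divide_right_mono sum_mono Z_le) auto
  also have "\<dots> = 1 / real k + \<delta>"
    using k by (simp add: sum.distrib field_simps power2_eq_square)
  finally have var: "variance V \<le> 1 / real k + \<delta>" .
  have "V \<omega> \<le> 1 \<and> 0 \<le> V \<omega>" if "\<omega> \<in> space M" for \<omega>
  proof -
    have "0 \<le> (\<Sum>j<k. Y j \<omega>)" "(\<Sum>j<k. Y j \<omega>) \<le> (\<Sum>j<k. 1)" using Y_bounds that by (auto intro!: sum_nonneg sum_mono simp del: sum_constant)
    then show ?thesis using k by (simp add: V_def)
  qed
  then have "integrable M (\<lambda>\<omega>. (V \<omega>)\<^sup>2)"
    using V_meas by (intro integrable_const_bound[where B=1] AE_I2) (auto simp: power_le_one)
  from Chebyshev_inequality[OF V_meas this \<gamma>]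
  have "prob {\<omega> \<in> space M. \<gamma> \<le> \<bar>V \<omega> - p\<bar>} \<le> variance V / \<gamma>\<^sup>2"
    by (simp add: \<open>expectation V = p\<close>)
  also have "\<dots> \<le> (1 / real k + \<delta>) / \<gamma>\<^sup>2" using var by (intro divide_right_mono) auto
  finally show ?thesis unfolding V_def .
qed

lemma outer_measure_of_le_emeasure:
  "A \<subseteq> C \<Longrightarrow> C \<in> sets M \<Longrightarrow> outer_measure_of M A \<le> emeasure M C"
  using outer_measure_of_mono[of A C M] by simp

context birth_death
begin

text \<open>The event need not be measurable, so it is covered by a null set and K + 1 deviation
  events. Off these no block is constant, since an average of 0 or 1 is at distance at least
  \<gamma> from a mean in [\<gamma>, 1 - \<gamma>], and K + 1 nonconstant blocks give too many
  exceptional times.\<close>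

lemma outer_measure_few_exceptional_times:
  assumes f: "f \<in> borel_measurable (counting_measure_space X B)"
    and f01: "\<And>\<mu>. \<mu> \<in> counting_measures X B \<Longrightarrow> f \<mu> \<in> {0, 1}"
    and regular: "jump_regular M \<eta>t f"
    and \<gamma>: "0 < \<gamma>" "\<gamma> \<le> expectation (\<lambda>\<omega>. f (\<eta> \<omega>))" "expectation (\<lambda>\<omega>. f (\<eta> \<omega>)) \<le> 1 - \<gamma>"
    and c: "0 < c" and k: "0 < k"
  shows "outer_measure_of M {\<omega> \<in> space M. cardinality (exceptional_times f (\<lambda>t. \<eta>t t \<omega>) \<inter> {0..c}) \<le> of_nat K} \<le>
    ennreal (real (Suc K) * ((1 / real k + (\<Sum>m=1..<k.
      \<bar>covariance M (\<lambda>\<omega>. f (\<eta> \<omega>)) (\<lambda>\<omega>. f (\<eta>t (real m / real (Suc K * k) * c) \<omega>))\<bar>)) / \<gamma>\<^sup>2))"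
proof -
  \<comment> \<open>One block more than the number of exceptional times that the event
    allows.\<close>
  define L where "L = Suc K"
  define p where "p = expectation (\<lambda>\<omega>. f (\<eta> \<omega>))"
  define \<tau> where "\<tau> q = c * real q / real (L * k)" for q
  define Cov where "Cov m = covariance M (\<lambda>\<omega>. f (\<eta> \<omega>)) (\<lambda>\<omega>. f (\<eta>t (real m / real (L * k) * c) \<omega>))" for m
  \<comment> \<open>The sum of absolute values dominates every covariance within a block, and for
    fixed \<open>k\<close> it tends to 0 term by term.\<close>
  define \<delta> where "\<delta> = (\<Sum>m=1..<k. \<bar>Cov m\<bar>)"
  define Y where "Y q \<omega> = f (\<eta>t (\<tau> q) \<omega>)" for q \<omega>
  define A where "A i = {\<omega> \<in> space M. \<gamma> \<le> \<bar>(\<Sum>j<k. Y (i * k + j) \<omega>) / real k - p\<bar>}" for i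
  have \<tau>_0: "0 \<le> \<tau> q" for q using c by (simp add: \<tau>_def)
  have Y_meas[measurable]: "Y q \<in> borel_measurable M" for q
    unfolding Y_def using measurable_compose[OF measurable_\<eta>t[OF \<tau>_0] f] .
  have A_sets[measurable]: "A i \<in> events" for i unfolding A_def by measurable
  have A_prob: "prob (A i) \<le> (1 / real k + \<delta>) / \<gamma>\<^sup>2" for i
    unfolding A_def
  proof (rule average_deviation[OF _ _ _ _ k \<gamma>(1)])
    show "Y (i * k + j) \<omega> \<in> {0, 1}" if "\<omega> \<in> space M" for j \<omega>
      unfolding Y_def by (intro f01 \<eta>t_counting_measures \<tau>_0 that)
    show "expectation (Y (i * k + j)) = p" for j
      unfolding Y_def p_def by (rule expectation_stationary[OF f \<tau>_0 order_refl])
    show "0 \<le> \<delta>" unfolding \<delta>_def by (intro sum_nonneg) auto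
    fix j j' assume j: "j < j'" "j' < k"
    have "\<tau> (i * k + j) \<le> \<tau> (i * k + j')"
      unfolding \<tau>_def using j c by (intro divide_right_mono mult_left_mono) auto
    \<comment> \<open>The lag depends on the difference of the sample indices only, so the same
      \<open>Cov m\<close> serve all blocks.\<close>
    moreover have "\<tau> (i * k + j') - \<tau> (i * k + j) = real (j' - j) / real (L * k) * c"
      using j by (simp add: \<tau>_def of_nat_diff diff_divide_distrib[symmetric] algebra_simps)
    ultimately have "covariance M (Y (i * k + j)) (Y (i * k + j')) = Cov (j' - j)"
      unfolding Y_def Cov_def using covariance_stationary[OF f \<tau>_0] by simp
    also have "\<dots> \<le> \<bar>Cov (j' - j)\<bar>" by simp
    also have "\<dots> \<le> \<delta>" unfolding \<delta>_def using j by (intro member_le_sum) auto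
    finally show "covariance M (Y (i * k + j)) (Y (i * k + j')) \<le> \<delta>" .
  qed simp
  from regular obtain N where N: "{\<omega> \<in> space M. \<not> piecewise_constant (\<lambda>t. f (\<eta>t t \<omega>))} \<subseteq> N" "N \<in> null_sets M"
    unfolding jump_regular_def by (elim AE_E) (auto simp: null_sets_def)
  have "{\<omega> \<in> space M. cardinality (exceptional_times f (\<lambda>t. \<eta>t t \<omega>) \<inter> {0..c}) \<le> of_nat K} \<subseteq> N \<union> (\<Union>i<L. A i)"
  proof safe
    fix \<omega> assume \<omega>: "\<omega> \<in> space M" and few: "cardinality (exceptional_times f (\<lambda>t. \<eta>t t \<omega>) \<inter> {0..c}) \<le> of_nat K"
      and notA: "\<omega> \<notin> (\<Union>i<L. A i)"
    show "\<omega> \<in> N"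
    proof (rule ccontr)
      assume "\<omega> \<notin> N"
      then have pc: "piecewise_constant (\<lambda>t. f (\<eta>t t \<omega>))" using N \<omega> by auto
      have "\<exists>j<k. f (\<eta>t (c * real (i * k + j) / real (L * k)) \<omega>) \<noteq> f (\<eta>t (c * real (i * k) / real (L * k)) \<omega>)"
        if i: "i < L" for i
      proof (rule ccontr)
        assume "\<not> ?thesis"
        then have "Y (i * k + j) \<omega> = Y (i * k) \<omega>" if "j < k" for j
          using that by (auto simp: Y_def \<tau>_def)
        then have "(\<Sum>j<k. Y (i * k + j) \<omega>) = real k * Y (i * k) \<omega>" by simp
        then have avg: "(\<Sum>j<k. Y (i * k + j) \<omega>) / real k = Y (i * k) \<omega>" using k by simp
        have "Y (i * k) \<omega> \<in> {0, 1}" unfolding Y_def by (intro f01 \<eta>t_counting_measures \<tau>_0 \<omega>)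
        then have "\<omega> \<in> A i" using \<omega> \<gamma> avg by (auto simp: A_def p_def)
        then show False using notA i by auto
      qed
      then have "of_nat L \<le> cardinality (exceptional_times f (\<lambda>t. \<eta>t t \<omega>) \<inter> {0..c})"
        using f01 \<eta>t_counting_measures[OF _ \<omega>] c k
        by (intro exceptional_times_ge_nonconstant_blocks[OF pc]) (auto simp: L_def)
      also note few
      finally show False unfolding L_def by (simp only: of_nat_le_iff)
    qed
  qed
  then have "outer_measure_of M {\<omega> \<in> space M. cardinality (exceptional_times f (\<lambda>t. \<eta>t t \<omega>) \<inter> {0..c}) \<le> of_nat K} \<le>
      emeasure M (N \<union> (\<Union>i<L. A i))"
    using N(2) by (intro outer_measure_of_le_emeasure) auto
  also have "\<dots> \<le> emeasure M N + emeasure M (\<Union>i<L. A i)"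
    using N(2) by (intro emeasure_subadditive) auto
  also have "emeasure M N = 0" using N(2) by auto
  also have "emeasure M (\<Union>i<L. A i) \<le> (\<Sum>i<L. emeasure M (A i))"
    by (intro emeasure_subadditive_finite) auto
  also have "\<dots> \<le> (\<Sum>i<L. ennreal ((1 / real k + \<delta>) / \<gamma>\<^sup>2))"
    using A_prob by (intro sum_mono) (simp add: emeasure_eq_measure ennreal_leI)
  also have "\<dots> = ennreal (real L * ((1 / real k + \<delta>) / \<gamma>\<^sup>2))"
  proof -
    have "0 \<le> (1 / real k + \<delta>) / \<gamma>\<^sup>2" using A_prob[of 0] measure_nonneg[of M "A 0"] by linarith
    then show ?thesis by (simp only: sum_constant card_lessThan ennreal_mult of_nat_0_le_iff ennreal_of_nat_eq_real_of_nat)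
  qed
  finally show ?thesis unfolding \<delta>_def Cov_def L_def by simp
qed

end

theorem theorem7p1:
  fixes M :: "'w measure" and X :: "'a measure" and B :: "nat \<Rightarrow> 'a set"
    and \<Lambda> :: "'a measure" and \<eta> :: "'w \<Rightarrow> 'a measure" and \<eta>t :: "real \<Rightarrow> 'w \<Rightarrow> 'a measure"
    and f :: "nat \<Rightarrow> 'a measure \<Rightarrow> real" and c :: "nat \<Rightarrow> real"
  assumes "prob_space M"
    and "borel_isomorphic X"
    and "localizing_sequence X B"
    and "locally_finite_measure X B \<Lambda>"
    and "poisson_process M X B \<Lambda> \<eta>"
    and "birth_death_process M X B \<Lambda> \<eta> \<eta>t"
    and "\<And>n. f n \<in> borel_measurable (counting_measure_space X B)"
    and "\<And>n \<mu>. \<mu> \<in> counting_measures X B \<Longrightarrow> f n \<mu> \<in> {0, 1}"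
    and "\<And>n. jump_regular M \<eta>t (f n)"
    and "non_degenerate M \<eta> f"
    and "\<And>n. 0 < c n \<and> c n < 1"
    and "\<And>\<beta>. 0 < \<beta> \<Longrightarrow> \<beta> < 1 \<Longrightarrow>
           (\<lambda>n. covariance M (\<lambda>\<omega>. f n (\<eta> \<omega>)) (\<lambda>\<omega>. f n (\<eta>t (\<beta> * c n) \<omega>))) \<longlonglongrightarrow> 0"
  shows "tends_to_infinity_in_probability M
           (\<lambda>n \<omega>. cardinality (exceptional_times (f n) (\<lambda>t. \<eta>t t \<omega>) \<inter> {0..c n}))"
proof -
  obtain \<kappa> x l \<kappa>' z l' where "birth_death M X B \<Lambda> \<eta> \<eta>t \<kappa> x l \<kappa>' z l'"
    using assms(1,3,4,6) unfolding birth_death_process_def birth_death_def birth_death_axioms_def by blast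
  then interpret birth_death M X B \<Lambda> \<eta> \<eta>t \<kappa> x l \<kappa>' z l' .
  obtain \<gamma> where \<gamma>: "0 < \<gamma>" "\<And>n. \<gamma> \<le> expectation (\<lambda>\<omega>. f n (\<eta> \<omega>))"
    "\<And>n. expectation (\<lambda>\<omega>. f n (\<eta> \<omega>)) \<le> 1 - \<gamma>"
    using assms(10) unfolding non_degenerate_def by auto
  show ?thesis
    unfolding tends_to_infinity_in_probability_def
  proof (intro allI order_tendstoI)
    fix K :: nat and a :: ennreal
    assume "0 < a"
    \<comment> \<open>\<open>a\<close> may be infinite; a real level \<open>e\<close> below it
      reduces the claim to a limit of real numbers.\<close>
    then obtain e where e: "0 < e" "ennreal e < a"
      by (metis dense ennreal_cases ennreal_less_zero_iff less_top not_less_iff_gr_or_eq top.not_eq_extremum)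
    define bound where "bound k n = real (Suc K) * ((1 / real k + (\<Sum>m=1..<k.
      \<bar>covariance M (\<lambda>\<omega>. f n (\<eta> \<omega>)) (\<lambda>\<omega>. f n (\<eta>t (real m / real (Suc K * k) * c n) \<omega>))\<bar>)) / \<gamma>\<^sup>2)" for k n
    \<comment> \<open>Fixed before \<open>n\<close>, with (K + 1) / (k \<gamma>^2) < e: this is the
      limit of \<open>bound k n\<close> once the finitely many covariances vanish.\<close>
    obtain k :: nat where k: "real (Suc K) / (\<gamma>\<^sup>2 * e) < real k" using reals_Archimedean2 by blast
    have "0 < real (Suc K) / (\<gamma>\<^sup>2 * e)" using \<gamma>(1) e(1) by simp
    then have "0 < k" using k by linarith
    have "(\<lambda>n. bound k n) \<longlonglongrightarrow> real (Suc K) * ((1 / real k + (\<Sum>m=1..<k. 0)) / \<gamma>\<^sup>2)"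
      unfolding bound_def
    proof (intro tendsto_intros tendsto_rabs_zero assms(12))
      fix m assume "m \<in> {1..<k}"
      \<comment> \<open>These bounds place \<beta> = m / ((K + 1) k) in (0,1), where the covariance
        hypothesis applies.\<close>
      then have "0 < m" "m < Suc K * k" by (auto intro: less_le_trans)
      then have "0 < real m" "real m < real (Suc K * k)" by (simp_all only: of_nat_less_iff of_nat_0_less_iff)
      then show "0 < real m / real (Suc K * k)" "real m / real (Suc K * k) < 1"
        by (auto simp: divide_less_eq)
    qed (use \<gamma>(1) in auto)
    moreover have "real (Suc K) * ((1 / real k + (\<Sum>m=1..<k. 0)) / \<gamma>\<^sup>2) < e"
      using k \<open>0 < k\<close> \<gamma>(1) e(1) by (simp add: field_simps)
    ultimately have "\<forall>\<^sub>F n in sequentially. bound k n < e" by (rule order_tendstoD(2))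
    then show "\<forall>\<^sub>F n in sequentially. outer_measure_of M
        {\<omega> \<in> space M. cardinality (exceptional_times (f n) (\<lambda>t. \<eta>t t \<omega>) \<inter> {0..c n}) \<le> of_nat K} < a"
    proof eventually_elim
      case (elim n)
      have "outer_measure_of M {\<omega> \<in> space M. cardinality (exceptional_times (f n) (\<lambda>t. \<eta>t t \<omega>) \<inter> {0..c n}) \<le> of_nat K}
          \<le> ennreal (bound k n)"
        unfolding bound_def using assms(7-9,11) \<gamma> \<open>0 < k\<close>
        by (intro outer_measure_few_exceptional_times) auto
      also have "\<dots> \<le> ennreal e" using elim by (intro ennreal_leI) simp
      also note e(2)
      finally show ?case .
    qed
  qed simp
qed

end
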